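(* Let $\mathcal{H}$ be a separable complex Hilbert space, let $(L_0,\widetilde L_0)$ be a pair of linear operators on $\mathcal{H}$ satisfying (T1) and (T2), and let $\mathcal{V}$ be a subspace of the graph space $\mathcal{W}$ satisfying condition (V). Put $L:=L_1|_{\mathcal{V}}$ and let $\beta>\alpha>0$. Then for any sequence $(C_n)_n$ in $\mathcal{F}(\alpha,\beta;L_0+\widetilde L_0,\mathcal{H})$ there exist a subsequence $(C_{n_k})_k$ and an operator $C\in\mathcal{F}(\alpha,\beta;L_0+\widetilde L_0,\mathcal{H})$ such that the subsequence $T_{n_k}:=L+C_{n_k}:\mathcal{V}\to\mathcal{H}$ G-converges to $T:=L+C:\mathcal{V}\to\mathcal{H}$.
   Context: Scalar products $\langle\,\cdot\mid\cdot\,\rangle$ are anti-linear in the second entry; $\|\cdot\|$ is the norm of $\mathcal{H}$; $\mathcal{L}(\mathcal{H})$ is the space of bounded linear operators on $\mathcal{H}$. Conditions on the pair $(L_0,\widetilde L_0)$: (T1) $L_0$ and $\widetilde L_0$ have a common domain $\mathcal{D}$, which is dense in $\mathcal{H}$, and $\langle L_0\phi\mid\psi\rangle=\langle\phi\mid\widetilde L_0\psi\rangle$ for all $\phi,\psi\in\mathcal{D}$. (T2) There is a constant $\lambda_L>0$ with $\|(L_0+\widetilde L_0)\phi\|\le 2\lambda_L\|\phi\|$ for all $\phi\in\mathcal{D}$. Put $L_1:=\widetilde L_0^{*}$ and $\widetilde L_1:=L_0^{*}$ (Hilbert space adjoints). Under (T1)--(T2) it is known that $L_0\subseteq L_1$,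 $\widetilde L_0\subseteq\widetilde L_1$, that $\operatorname{dom}L_1=\operatorname{dom}\widetilde L_1=:\mathcal{W}$ (the graph space), and that the closure $\overline{L_0+\widetilde L_0}$ is an everywhere defined bounded self-adjoint operator on $\mathcal{H}$. The space $\mathcal{W}$ is equipped with the graph norm $\|u\|_{L_1}=\|u\|+\|L_1u\|$, which is equivalent to the norm induced by the inner product $\langle u\mid v\rangle+\langle L_1u\mid L_1v\rangle$, with which $\mathcal{W}$ is a Hilbert space. Weak convergence in $\mathcal{W}$ refers to this Hilbert space structure; equivalently, $u_n\rightharpoonup u$ in $\mathcal{W}$ iff $u_n\rightharpoonup u$ and $L_1u_n\rightharpoonup L_1u$ weakly in $\mathcal{H}$. Indefinite inner product on $\mathcal{W}$: $[\,u\mid v\,]:=\langle L_1u\mid v\rangle-\langle u\mid\widetilde L_1v\rangle$ for $u,v\in\mathcal{W}$. For $S\subseteq\mathcal{W}$, $S^{[\perp]}:=\{u\in\mathcal{W}: [\,u\mid v\,]=0 \text{ for all } v\in S\}$. Condition (V) for a subspace $\mathcal{V}\subseteq\mathcal{W}$: with $\widetilde{\mathcal{V}}:=\mathcal{V}^{[\perp]}$ one has $\mathcal{V}=\widetilde{\mathcal{V}}^{[\perp]}$, and $[\,u\mid u\,]\ge 0$ for all $u\in\mathcal{V}$, $[\,v\mid v\,]\le 0$ for all $v\in\widetilde{\mathcal{V}}$. The set $\mathcal{F}(\alpha,\beta;L_0+\widetilde L_0,\mathcal{H})$ consists of all $C\in\mathcal{L}(\mathcal{H})$ such that for every $\varphi\in\mathcal{H}$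 $$\operatorname{Re}\Bigl\langle \bigl(C+\tfrac12\overline{L_0+\widetilde L_0}\bigr)\varphi \Bigm| \varphi\Bigr\rangle\ge\alpha\|\varphi\|^2,\qquad \operatorname{Re}\Bigl\langle \bigl(C+\tfrac12\overline{L_0+\widetilde L_0}\bigr)\varphi \Bigm| \varphi\Bigr\rangle\ge\frac1\beta\Bigl\|\bigl(C+\tfrac12\overline{L_0+\widetilde L_0}\bigr)\varphi\Bigr\|^2.$$ For every such $C$ and every $\mathcal{V}$ satisfying (V), it is known that $L+C:\mathcal{V}\to\mathcal{H}$ (with $L=L_1|_{\mathcal{V}}$) is an isomorphism when $\mathcal{V}$ carries the graph norm. G-convergence: for a sequence $(C_n)_n$ in $\mathcal{F}(\alpha,\beta;L_0+\widetilde L_0,\mathcal{H})$, the sequence of isomorphisms $T_n:=L+C_n:\mathcal{V}\to\mathcal{H}$ G-converges to an isomorphism $T:=L+C:\mathcal{V}\to\mathcal{H}$, for some $C\in\mathcal{F}(\alpha,\beta;L_0+\widetilde L_0,\mathcal{H})$, if for every $f\in\mathcal{H}$ one has $T_n^{-1}f\rightharpoonup T^{-1}f$ weakly in $\mathcal{W}$. *)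

theory Defs
  imports "HOL-Analysis.Analysis"
begin

text \<open>
  Complex Hilbert spaces. The real inner product of class real_inner is required to be the
  real part of the complex one, so the norm and the topology are those of the underlying real
  inner product space. The complex scalar product is anti-linear in the second entry.
\<close>

class complex_inner = real_inner +
  fixes scaleC :: "complex \<Rightarrow> 'a \<Rightarrow> 'a"  (infixr \<open>*\<^sub>C\<close> 75)
    and cinner :: "'a \<Rightarrow> 'a \<Rightarrow> complex"
  assumes scaleC_add_right: "a *\<^sub>C (x + y) = a *\<^sub>C x + a *\<^sub>C y"
    and scaleC_add_left: "(a + b) *\<^sub>C x = a *\<^sub>C x + b *\<^sub>C x"
    and scaleC_scaleC: "a *\<^sub>C (b *\<^sub>C x) = (a * b) *\<^sub>C x"
    and scaleC_of_real: "complex_of_real r *\<^sub>C x = r *\<^sub>R x"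
    and cinner_commute: "cinner x y = cnj (cinner y x)"
    and cinner_add_left: "cinner (x + y) z = cinner x z + cinner y z"
    and cinner_scaleC_left: "cinner (a *\<^sub>C x) y = a * cinner x y"
    and Re_cinner: "Re (cinner x y) = inner x y"

class complex_hilbert = complex_inner + complete_space

instantiation complex :: complex_hilbert
begin

definition scaleC_complex :: "complex \<Rightarrow> complex \<Rightarrow> complex" where
  "scaleC_complex a x = a * x"

definition cinner_complex :: "complex \<Rightarrow> complex \<Rightarrow> complex" where
  "cinner_complex x y = x * cnj y"

instance
  by standard
    (auto simp: scaleC_complex_def cinner_complex_def inner_complex_def algebra_simps
      scaleR_conv_of_real)

end

definition csubspace :: "'a::complex_inner set \<Rightarrow> bool" where
  "csubspace S \<longleftrightarrow>
     0 \<in> S \<and> (\<forall>x\<in>S. \<forall>y\<in>S. x + y \<in> S) \<and> (\<forall>c. \<forall>x\<in>S. c *\<^sub>C x \<in> S)"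

definition clinear_on :: "'a::complex_inner set \<Rightarrow> ('a \<Rightarrow> 'a) \<Rightarrow> bool" where
  "clinear_on S A \<longleftrightarrow>
     (\<forall>x\<in>S. \<forall>y\<in>S. A (x + y) = A x + A y) \<and> (\<forall>c. \<forall>x\<in>S. A (c *\<^sub>C x) = c *\<^sub>C A x)"

text \<open>
  A (possibly unbounded) operator is given by its domain D and a total function A, whose
  values outside D are irrelevant.
\<close>

definition linear_operator :: "'a::complex_inner set \<Rightarrow> ('a \<Rightarrow> 'a) \<Rightarrow> bool" where
  "linear_operator D A \<longleftrightarrow> csubspace D \<and> clinear_on D A"

definition bounded_operators :: "('a::complex_inner \<Rightarrow> 'a) set" where
  "bounded_operators = {C. clinear_on UNIV C \<and> (\<exists>K. \<forall>x. norm (C x) \<le> K * norm x)}"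

definition adj_dom :: "'a::complex_inner set \<Rightarrow> ('a \<Rightarrow> 'a) \<Rightarrow> 'a set" where
  "adj_dom D A = {v. \<exists>w. \<forall>\<phi>\<in>D. cinner (A \<phi>) v = cinner \<phi> w}"

text \<open>The description is unique on \<^const>\<open>adj_dom\<close> when D is dense.\<close>

definition adj_op :: "'a::complex_inner set \<Rightarrow> ('a \<Rightarrow> 'a) \<Rightarrow> 'a \<Rightarrow> 'a" where
  "adj_op D A v = (THE w. \<forall>\<phi>\<in>D. cinner (A \<phi>) v = cinner \<phi> w)"

text \<open>The operator whose graph is the closure of the graph of A on D (for closable A).\<close>

definition closure_op :: "'a::complex_inner set \<Rightarrow> ('a \<Rightarrow> 'a) \<Rightarrow> 'a \<Rightarrow> 'a" where
  "closure_op D A x = (THE y. (x, y) \<in> closure ((\<lambda>\<phi>. (\<phi>, A \<phi>)) ` D))"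

definition cond_T1 :: "'a::complex_inner set \<Rightarrow> ('a \<Rightarrow> 'a) \<Rightarrow> ('a \<Rightarrow> 'a) \<Rightarrow> bool" where
  "cond_T1 D L0 L0t \<longleftrightarrow>
     closure D = UNIV \<and> (\<forall>\<phi>\<in>D. \<forall>\<psi>\<in>D. cinner (L0 \<phi>) \<psi> = cinner \<phi> (L0t \<psi>))"

definition cond_T2 :: "'a::complex_inner set \<Rightarrow> ('a \<Rightarrow> 'a) \<Rightarrow> ('a \<Rightarrow> 'a) \<Rightarrow> bool" where
  "cond_T2 D L0 L0t \<longleftrightarrow>
     (\<exists>l>0. \<forall>\<phi>\<in>D. norm (L0 \<phi> + L0t \<phi>) \<le> 2 * l * norm \<phi>)"

definition op_L1 :: "'a::complex_inner set \<Rightarrow> ('a \<Rightarrow> 'a) \<Rightarrow> ('a \<Rightarrow> 'a) \<Rightarrow> 'a \<Rightarrow> 'a" where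
  "op_L1 D L0 L0t = adj_op D L0t"

definition op_L1t :: "'a::complex_inner set \<Rightarrow> ('a \<Rightarrow> 'a) \<Rightarrow> ('a \<Rightarrow> 'a) \<Rightarrow> 'a \<Rightarrow> 'a" where
  "op_L1t D L0 L0t = adj_op D L0"

text \<open>
  The graph space is the domain of \<^const>\<open>op_L1\<close>; under \<^const>\<open>cond_T1\<close> and \<^const>\<open>cond_T2\<close>
  it is also the domain of \<^const>\<open>op_L1t\<close>.
\<close>

definition graph_space :: "'a::complex_inner set \<Rightarrow> ('a \<Rightarrow> 'a) \<Rightarrow> ('a \<Rightarrow> 'a) \<Rightarrow> 'a set" where
  "graph_space D L0 L0t = adj_dom D L0t"

definition graph_norm :: "('a::complex_inner \<Rightarrow> 'a) \<Rightarrow> 'a \<Rightarrow> real" where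
  "graph_norm A u = norm u + norm (A u)"

definition graph_cinner :: "('a::complex_inner \<Rightarrow> 'a) \<Rightarrow> 'a \<Rightarrow> 'a \<Rightarrow> complex" where
  "graph_cinner A u v = cinner u v + cinner (A u) (A v)"

text \<open>
  Weak convergence in the Hilbert space consisting of W (the domain of A) with
  \<^const>\<open>graph_cinner\<close> as scalar product.
\<close>

definition weakly_converges ::
  "'a::complex_inner set \<Rightarrow> ('a \<Rightarrow> 'a) \<Rightarrow> (nat \<Rightarrow> 'a) \<Rightarrow> 'a \<Rightarrow> bool" where
  "weakly_converges W A u u' \<longleftrightarrow>
     (\<forall>n. u n \<in> W) \<and> u' \<in> W \<and>
     (\<forall>v\<in>W. (\<lambda>n. graph_cinner A (u n) v) \<longlonglongrightarrow> graph_cinner A u' v)"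

definition indef_inner ::
  "'a::complex_inner set \<Rightarrow> ('a \<Rightarrow> 'a) \<Rightarrow> ('a \<Rightarrow> 'a) \<Rightarrow> 'a \<Rightarrow> 'a \<Rightarrow> complex" where
  "indef_inner D L0 L0t u v = cinner (op_L1 D L0 L0t u) v - cinner u (op_L1t D L0 L0t v)"

definition indef_perp ::
  "'a::complex_inner set \<Rightarrow> ('a \<Rightarrow> 'a) \<Rightarrow> ('a \<Rightarrow> 'a) \<Rightarrow> 'a set \<Rightarrow> 'a set" where
  "indef_perp D L0 L0t S =
     {u \<in> graph_space D L0 L0t. \<forall>v\<in>S. indef_inner D L0 L0t u v = 0}"

definition cond_V ::
  "'a::complex_inner set \<Rightarrow> ('a \<Rightarrow> 'a) \<Rightarrow> ('a \<Rightarrow> 'a) \<Rightarrow> 'a set \<Rightarrow> bool" where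
  "cond_V D L0 L0t V \<longleftrightarrow>
     V = indef_perp D L0 L0t (indef_perp D L0 L0t V) \<and>
     (\<forall>u\<in>V. indef_inner D L0 L0t u u \<in> \<real>\<^sub>\<ge>\<^sub>0) \<and>
     (\<forall>v\<in>indef_perp D L0 L0t V. indef_inner D L0 L0t v v \<in> \<real>\<^sub>\<le>\<^sub>0)"

text \<open>The set F depends on the pair only through the operator A = L0 + L0t with domain D.\<close>

definition coeff_class ::
  "real \<Rightarrow> real \<Rightarrow> 'a::complex_inner set \<Rightarrow> ('a \<Rightarrow> 'a) \<Rightarrow> ('a \<Rightarrow> 'a) set" where
  "coeff_class \<alpha> \<beta> D A =
     {C \<in> bounded_operators.
        \<forall>\<phi>. let w = C \<phi> + (1 / 2) *\<^sub>C closure_op D A \<phi> in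
          Re (cinner w \<phi>) \<ge> \<alpha> * (norm \<phi>)\<^sup>2 \<and>
          Re (cinner w \<phi>) \<ge> 1 / \<beta> * (norm w)\<^sup>2}"

text \<open>T is a linear homeomorphism of V, with the graph norm of A, onto the whole space.\<close>

definition graph_isomorphism ::
  "'a::complex_inner set \<Rightarrow> ('a \<Rightarrow> 'a) \<Rightarrow> ('a \<Rightarrow> 'a) \<Rightarrow> bool" where
  "graph_isomorphism V A T \<longleftrightarrow>
     clinear_on V T \<and> bij_betw T V UNIV \<and>
     (\<exists>K. \<forall>u\<in>V. norm (T u) \<le> K * graph_norm A u) \<and>
     (\<exists>K. \<forall>u\<in>V. graph_norm A u \<le> K * norm (T u))"

text \<open>G-convergence of isomorphisms from V to the whole space, V being a subspace of W = dom A.\<close>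

definition G_converges ::
  "'a::complex_inner set \<Rightarrow> ('a \<Rightarrow> 'a) \<Rightarrow> 'a set \<Rightarrow> (nat \<Rightarrow> 'a \<Rightarrow> 'a) \<Rightarrow> ('a \<Rightarrow> 'a) \<Rightarrow> bool"
where
  "G_converges W A V T T' \<longleftrightarrow>
     (\<forall>n. graph_isomorphism V A (T n)) \<and> graph_isomorphism V A T' \<and>
     (\<forall>f. weakly_converges W A (\<lambda>n. inv_into V (T n) f) (inv_into V T' f))"

end

theory Submission
  imports Defs "HOL-Library.Diagonal_Subsequence"
begin

text \<open>
  Write \<open>S\<close> for the closure of \<open>L0 + L0t\<close>, a bounded self-adjoint operator, and
  \<open>B = C + S/2\<close>. On the graph space \<open>L1t = S - L1\<close>, so \<open>L1 - S/2\<close> is skew-symmetric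
  up to the boundary form: \<open>Re [u|u] = 2 Re \<langle>L1 u - S u/2 | u\<rangle>\<close>. Since
  \<open>L1 + C = (L1 - S/2) + B\<close>, the sign of the form on \<open>V\<close> and the coercivity of \<open>B\<close> give
  \<open>Re \<langle>(L1 + C) u | u\<rangle> \<ge> \<alpha> \<parallel>u\<parallel>\<^sup>2\<close> for \<open>u \<in> V\<close>. Hence \<open>L1 + C\<close> is injective on \<open>V\<close>
  with closed range. A vector \<open>f\<close> orthogonal to the range lies in the graph space and in
  the orthogonal companion of \<open>V\<close> for the form, where \<open>0 \<ge> Re [f|f] = 2 Re \<langle>B f | f\<rangle>\<close>, so
  \<open>f = 0\<close>. This makes \<open>L1 + C\<close> an isomorphism (\<open>graph_isomorphism_T\<close>).

  For compactness, the inverses \<open>R n\<close> of \<open>L1 + C n\<close> satisfy \<open>\<parallel>R n f\<parallel> \<le> \<parallel>f\<parallel>/\<alpha>\<close>, so by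
  separability a subsequence converges weakly, at every \<open>f\<close>, to \<open>U f\<close> for a linear
  operator \<open>U\<close>; the images under \<open>L1\<close> are bounded too and converge weakly to \<open>L1 (U f)\<close>
  (\<open>solutions_weakly_compact\<close>). The coefficient of the limit problem is read off from \<open>U\<close>:
  it has to send \<open>u = U f\<close> to \<open>w = f - L1 u + S u/2\<close>, which is the weak limit of the vectors
  \<open>B n (R n f)\<close>. The nonnegative form is weakly lower semicontinuous on \<open>V\<close>, and so is
  the norm; together they carry both inequalities of the class over to the limit
  (\<open>weak_limit_coercive\<close>):
  \<open>\<alpha> \<parallel>u\<parallel>\<^sup>2 \<le> Re \<langle>w|u\<rangle>\<close> and \<open>\<parallel>w\<parallel>\<^sup>2/\<beta> \<le> Re \<langle>w|u\<rangle>\<close>.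

  These inequalities do the rest. If \<open>u = 0\<close>, then \<open>w = 0\<close> and so \<open>f = 0\<close>: \<open>U\<close> is
  injective and \<open>u \<mapsto> w\<close> is well defined, with bound \<open>\<beta>\<close>. If \<open>f\<close> is orthogonal to the range of
  \<open>U\<close>, then \<open>\<alpha> \<parallel>U f\<parallel>\<^sup>2 \<le> Re \<langle>f|U f\<rangle> = 0\<close>, so \<open>f = 0\<close>: the range is dense. Thus \<open>u \<mapsto> w\<close>
  extends to a bounded operator \<open>B\<close> on the whole space, the inequalities persist by
  continuity, and \<open>C' = B - S/2\<close> is the limit coefficient, because
  \<open>(L1 + C') (U f) = f\<close>.
\<close>

section \<open>Real Hilbert spaces\<close>

text \<open>
  The vector \<open>z\<close> minimises \<open>\<parallel>x\<parallel>\<^sup>2 - 2 l x\<close> over \<open>M\<close>. One statement serves two purposes: with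
  \<open>M = UNIV\<close> it is the representation theorem of Riesz, and with \<open>l = inner y\<close> it gives the
  orthogonal projection of \<open>y\<close> onto \<open>M\<close>.
\<close>

lemma riesz_on_closed_subspace:
  fixes M :: "'a::{real_inner,complete_space} set"
  assumes sub: "subspace M" and cl: "closed M" and l: "bounded_linear l"
  shows "\<exists>z\<in>M. \<forall>x\<in>M. inner z x = l x"
proof -
  interpret l: bounded_linear l by (rule l)
  define J where "J x = (norm x)\<^sup>2 - 2 * l x" for x
  obtain K where K: "\<And>x. norm (l x) \<le> norm x * K"
    using l.bounded by blast
  have J_ge: "J x \<ge> - K\<^sup>2" for x
  proof -
    have "l x \<le> norm x * K" using K[of x] by auto
    moreover have "0 \<le> (norm x - K)\<^sup>2" by simp
    ultimately show ?thesis unfolding J_def power2_diff by linarith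
  qed
  define m where "m = (INF x\<in>M. J x)"
  have "0 \<in> M" using sub by (rule subspace_0)
  have bdd: "bdd_below (J ` M)" by (rule bdd_belowI[where m="- K\<^sup>2"]) (use J_ge in auto)
  have m_le: "m \<le> J x" if "x \<in> M" for x
    unfolding m_def by (rule cINF_lower[OF bdd that])
  have "\<exists>x\<in>M. J x < m + 1 / Suc n" for n
  proof -
    have "m < m + 1 / Suc n" by simp
    then show ?thesis
      unfolding m_def using cINF_less_iff[OF _ bdd] \<open>0 \<in> M\<close> by blast
  qed
  then obtain X where X: "\<And>n. X n \<in> M" "\<And>n. J (X n) < m + 1 / Suc n" by metis
  \<comment> \<open>The parallelogram law makes minimising sequences Cauchy.\<close>
  have par: "(norm (x - y))\<^sup>2 \<le> 2 * (J x + J y - 2 * m)" if "x \<in> M" "y \<in> M" for x y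
  proof -
    let ?h = "(1/2) *\<^sub>R (x + y)"
    have "?h \<in> M" using sub that by (simp add: subspace_add subspace_scale)
    then have "m \<le> J ?h" by (rule m_le)
    moreover have "J x + J y = 2 * J ?h + (norm (x - y))\<^sup>2 / 2"
      unfolding J_def power2_norm_eq_inner
      by (simp add: l.add l.scaleR inner_commute[of y x] inner_add_left inner_add_right
          inner_diff_left inner_diff_right field_simps)
    ultimately show ?thesis by simp
  qed
  have "Cauchy X"
  proof (rule metric_CauchyI)
    fix e :: real assume "e > 0"
    then obtain N where N: "inverse (real (Suc N)) < e\<^sup>2 / 4"
      using reals_Archimedean[of "e\<^sup>2 / 4"] by auto
    have "dist (X i) (X j) < e" if "i \<ge> N" "j \<ge> N" for i j
    proof -
      have "J (X n) < m + e\<^sup>2 / 4" if "n \<ge> N" for n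
      proof -
        have "1 / real (Suc n) \<le> inverse (real (Suc N))"
          using that by (simp add: field_simps)
        then show ?thesis using N X(2)[of n] by linarith
      qed
      then have "J (X i) < m + e\<^sup>2 / 4" "J (X j) < m + e\<^sup>2 / 4" using that by auto
      then have "J (X i) + J (X j) < (m + e\<^sup>2 / 4) + (m + e\<^sup>2 / 4)" by (rule add_strict_mono)
      then have "J (X i) + J (X j) - 2 * m < e\<^sup>2 / 2" by simp
      then have "2 * (J (X i) + J (X j) - 2 * m) < e\<^sup>2" by simp
      with par[OF X(1) X(1), of i j] have "(norm (X i - X j))\<^sup>2 < e\<^sup>2"
        by (rule le_less_trans)
      then show ?thesis
        using \<open>e > 0\<close> by (simp add: dist_norm power2_less_imp_less)
    qed
    then show "\<exists>N. \<forall>i\<ge>N. \<forall>j\<ge>N. dist (X i) (X j) < e" by blast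
  qed
  then obtain z where z: "X \<longlonglongrightarrow> z" using Cauchy_convergent convergent_def by blast
  have "z \<in> M" using closed_sequentially[OF cl] X(1) z by blast
  have "(\<lambda>n. J (X n)) \<longlonglongrightarrow> J z"
    unfolding J_def by (intro tendsto_intros z l.tendsto)
  moreover have "(\<lambda>n. m + 1 / Suc n) \<longlonglongrightarrow> m + 0"
    by (intro tendsto_intros LIMSEQ_Suc[OF lim_1_over_n])
  ultimately have "J z \<le> m + 0"
    by (rule LIMSEQ_le) (use X(2) less_imp_le in blast)
  have "inner z x = l x" if "x \<in> M" for x
  proof (rule ccontr)
    assume ne: "inner z x \<noteq> l x"
    then have "x \<noteq> 0" by auto
    define d where "d = inner z x - l x"
    \<comment> \<open>This is the minimum point of the parabola \<open>t \<mapsto> J (z + t x)\<close>.\<close>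
    define t where "t = - d / (norm x)\<^sup>2"
    have "z + t *\<^sub>R x \<in> M" using sub that \<open>z \<in> M\<close> by (simp add: subspace_add subspace_scale)
    from m_le[OF this] have "J z \<le> J (z + t *\<^sub>R x)" using \<open>J z \<le> m + 0\<close> by simp
    also have "J (z + t *\<^sub>R x) = J z + t\<^sup>2 * (norm x)\<^sup>2 + 2 * t * d"
      unfolding J_def d_def power2_norm_eq_inner
      by (simp add: l.add l.scaleR inner_commute power2_eq_square algebra_simps)
    also have "t\<^sup>2 * (norm x)\<^sup>2 + 2 * t * d = - (d\<^sup>2 / (norm x)\<^sup>2)"
      using \<open>x \<noteq> 0\<close> by (simp add: t_def power2_eq_square field_simps)
    then have "J z + t\<^sup>2 * (norm x)\<^sup>2 + 2 * t * d = J z - d\<^sup>2 / (norm x)\<^sup>2" by simp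
    finally have "d\<^sup>2 / (norm x)\<^sup>2 \<le> 0" by simp
    moreover have "d\<^sup>2 / (norm x)\<^sup>2 > 0" using ne \<open>x \<noteq> 0\<close> by (simp add: d_def)
    ultimately show False by simp
  qed
  with \<open>z \<in> M\<close> show ?thesis by blast
qed

lemma subspace_closure:
  fixes M :: "'a::real_normed_vector set"
  assumes "subspace M"
  shows "subspace (closure M)"
proof (rule subspaceI)
  show "0 \<in> closure M" using subspace_0[OF assms] closure_subset by blast
next
  fix x y assume "x \<in> closure M" "y \<in> closure M"
  then obtain X Y where XY: "\<And>n. X n \<in> M" "X \<longlonglongrightarrow> x" "\<And>n. Y n \<in> M" "Y \<longlonglongrightarrow> y"
    unfolding closure_sequential by blast
  have "(\<lambda>n. X n + Y n) \<longlonglongrightarrow> x + y" by (intro tendsto_intros XY)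
  then show "x + y \<in> closure M"
    unfolding closure_sequential
    by (intro exI[of _ "\<lambda>n. X n + Y n"]) (simp add: subspace_add[OF assms] XY)
next
  fix c :: real and x assume "x \<in> closure M"
  then obtain X where X: "\<And>n. X n \<in> M" "X \<longlonglongrightarrow> x" unfolding closure_sequential by blast
  have "(\<lambda>n. c *\<^sub>R X n) \<longlonglongrightarrow> c *\<^sub>R x" by (intro tendsto_intros X)
  then show "c *\<^sub>R x \<in> closure M"
    unfolding closure_sequential
    by (intro exI[of _ "\<lambda>n. c *\<^sub>R X n"]) (simp add: subspace_scale[OF assms] X)
qed

lemma orthogonal_trivial_imp_dense:
  fixes M :: "'a::{real_inner,complete_space} set"
  assumes "subspace M" and orth: "\<And>y. (\<And>x. x \<in> M \<Longrightarrow> inner x y = 0) \<Longrightarrow> y = 0"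
  shows "closure M = UNIV"
proof -
  have "y \<in> closure M" for y
  proof -
    have "\<exists>z\<in>closure M. \<forall>x\<in>closure M. inner z x = inner y x"
      by (rule riesz_on_closed_subspace[OF subspace_closure[OF assms(1)] closed_closure
          bounded_linear_inner_right])
    then obtain z where z: "z \<in> closure M" "\<forall>x\<in>closure M. inner z x = inner y x" ..
    have "y - z = 0"
    proof (rule orth)
      fix x assume "x \<in> M"
      then have "inner z x = inner y x" using z(2) closure_subset[of M] by blast
      then show "inner x (y - z) = 0" by (simp add: inner_diff_right inner_commute)
    qed
    then have "y = z" by simp
    then show ?thesis using z(1) by simp
  qed
  then show ?thesis by blast
qed

lemma inner_dense_eq_0:
  fixes v :: "'a::real_inner"
  assumes "closure D = UNIV" and "\<And>x. x \<in> D \<Longrightarrow> inner x v = 0"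
  shows "v = 0"
proof -
  have "closed {x. inner x v = 0}" by (intro closed_Collect_eq continuous_intros)
  then have "closure D \<subseteq> {x. inner x v = 0}"
    by (rule closure_minimal[rotated]) (use assms(2) in blast)
  then have "inner v v = 0" using assms(1) by blast
  then show ?thesis by simp
qed

text \<open>
  The Lipschitz constant does not depend on \<open>n\<close>, so the functions \<open>a n\<close> are equicontinuous
  and the Cauchy property spreads from the dense set by an \<open>\<epsilon>/3\<close> argument.
\<close>

lemma convergent_on_dense_imp_convergent:
  fixes a :: "nat \<Rightarrow> 'b::metric_space \<Rightarrow> real"
  assumes dense: "closure Q = UNIV"
    and conv: "\<And>x. x \<in> Q \<Longrightarrow> convergent (\<lambda>n. a n x)"
    and lip: "\<And>n x y. \<bar>a n x - a n y\<bar> \<le> M * dist x y"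
  shows "convergent (\<lambda>n. a n x)"
proof (rule Cauchy_convergent, rule metric_CauchyI)
  fix e :: real assume "e > 0"
  define M' where "M' = \<bar>M\<bar> + 1"
  have M': "M' > 0" "M \<le> M'" by (auto simp: M'_def)
  have "x \<in> closure Q" using dense by simp
  then obtain y where y: "y \<in> Q" "dist y x < e / (3 * M')"
    unfolding closure_approachable using M' \<open>e > 0\<close> by (meson divide_pos_pos mult_pos_pos zero_less_numeral)
  have near: "\<bar>a n x - a n y\<bar> < e / 3" for n
  proof -
    have "\<bar>a n x - a n y\<bar> \<le> M * dist x y" by (rule lip)
    also have "\<dots> \<le> M' * dist x y" using M' by (intro mult_right_mono) auto
    also have "\<dots> < e / 3" using y(2) M' by (simp add: dist_commute field_simps)
    finally show ?thesis .
  qed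
  obtain N where N: "\<And>i j. i \<ge> N \<Longrightarrow> j \<ge> N \<Longrightarrow> dist (a i y) (a j y) < e / 3"
    using metric_CauchyD[OF convergent_Cauchy[OF conv[OF y(1)]], of "e/3"] \<open>e > 0\<close> by auto
  have "dist (a i x) (a j x) < e" if "i \<ge> N" "j \<ge> N" for i j
    using near[of i] near[of j] N[OF that] unfolding dist_real_def by linarith
  then show "\<exists>N. \<forall>i\<ge>N. \<forall>j\<ge>N. dist (a i x) (a j x) < e" by blast
qed

text \<open>
  The limits \<open>l g\<close> of the scalar sequences exist for every \<open>g\<close> and form a bounded linear
  functional, which the Riesz theorem represents by a vector. Testing on a dense set is what
  makes the lemma usable for \<open>L1\<close>, where convergence is first known on the domain of \<open>L0\<close> only.
\<close>

lemma bounded_weakly_Cauchy_imp_weak_limit: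
  fixes x :: "nat \<Rightarrow> 'a::{real_inner,complete_space}"
  assumes dense: "closure Q = UNIV"
    and conv: "\<And>g. g \<in> Q \<Longrightarrow> convergent (\<lambda>n. inner (x n) g)"
    and bound: "\<And>n. norm (x n) \<le> K"
  shows "\<exists>u. \<forall>g. (\<lambda>n. inner (x n) g) \<longlonglongrightarrow> inner u g"
proof -
  have "convergent (\<lambda>n. inner (x n) g)" for g
  proof (rule convergent_on_dense_imp_convergent[OF dense conv])
    fix n g h
    have "\<bar>inner (x n) (g - h)\<bar> \<le> norm (x n) * norm (g - h)" by (rule Cauchy_Schwarz_ineq2)
    also have "\<dots> \<le> K * norm (g - h)" using bound by (intro mult_right_mono) auto
    finally show "\<bar>inner (x n) g - inner (x n) h\<bar> \<le> K * dist g h"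
      by (simp add: inner_diff_right dist_norm)
  qed
  then obtain l where l: "\<And>g. (\<lambda>n. inner (x n) g) \<longlonglongrightarrow> l g"
    unfolding convergent_def by metis
  have "bounded_linear l"
  proof
    fix g h :: 'a and c :: real
    have "(\<lambda>n. inner (x n) (g + h)) \<longlonglongrightarrow> l g + l h"
      unfolding inner_add_right by (intro tendsto_intros l)
    from LIMSEQ_unique[OF l this] show "l (g + h) = l g + l h" .
    have "(\<lambda>n. inner (x n) (c *\<^sub>R g)) \<longlonglongrightarrow> c * l g"
      unfolding inner_scaleR_right by (intro tendsto_intros l)
    from LIMSEQ_unique[OF l this] show "l (c *\<^sub>R g) = c *\<^sub>R l g" by simp
  next
    have "norm (l g) \<le> norm g * K" for g
    proof (rule LIMSEQ_le_const2)
      show "(\<lambda>n. norm (inner (x n) g)) \<longlonglongrightarrow> norm (l g)" by (intro tendsto_intros l)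
      have "norm (inner (x n) g) \<le> norm g * K" for n
        using Cauchy_Schwarz_ineq2[of "x n" g] mult_right_mono[OF bound[of n] norm_ge_zero[of g]]
        by (simp add: mult.commute)
      then show "\<exists>N. \<forall>n\<ge>N. norm (inner (x n) g) \<le> norm g * K" by blast
    qed
    then show "\<exists>K. \<forall>g. norm (l g) \<le> norm g * K" by blast
  qed
  then obtain u where u: "\<And>g. inner u g = l g"
    using riesz_on_closed_subspace[OF subspace_UNIV closed_UNIV] by blast
  show ?thesis by (rule exI[of _ u]) (simp add: u l)
qed

text \<open>
  A bounded set of operators on a separable space is sequentially compact in the weak operator
  topology: a diagonal sequence makes the countably many matrix entries with indices in \<open>Q\<close>
  converge, and the uniform bound extends this first to all \<open>f\<close> and then to all \<open>g\<close>.
\<close>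

lemma bounded_operators_weak_limit:
  fixes R :: "nat \<Rightarrow> 'a::{real_inner,complete_space} \<Rightarrow> 'a"
  assumes Q: "countable Q" "closure Q = (UNIV :: 'a set)"
    and lin: "\<And>n. linear (R n)" and bound: "\<And>n f. norm (R n f) \<le> K * norm f"
  shows "\<exists>r U. strict_mono r \<and> (\<forall>f g. (\<lambda>k. inner (R (r k) f) g) \<longlonglongrightarrow> inner (U f) g)"
proof -
  have "Q \<noteq> {}" using Q(2) by auto
  define p where "p = from_nat_into (Q \<times> Q)"
  have p: "range p = Q \<times> Q"
    unfolding p_def using \<open>Q \<noteq> {}\<close> Q(1) by (intro range_from_nat_into) auto
  define P where "P i s \<longleftrightarrow> convergent (\<lambda>k. inner (R (s k) (fst (p i))) (snd (p i)))"
    for i and s :: "nat \<Rightarrow> nat"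
  have abs_le: "\<bar>inner (R n f) g\<bar> \<le> K * norm f * norm g" for n f g
    using Cauchy_Schwarz_ineq2[of "R n f" g] mult_right_mono[OF bound[of n f] norm_ge_zero[of g]]
    by linarith
  interpret subseqs P
  proof
    fix i and s :: "nat \<Rightarrow> nat"
    let ?a = "\<lambda>k. inner (R (s k) (fst (p i))) (snd (p i))"
    have "bounded (range ?a)"
      by (rule boundedI[where B="K * norm (fst (p i)) * norm (snd (p i))"]) (use abs_le in auto)
    then obtain l r where "strict_mono r" "(?a \<circ> r) \<longlonglongrightarrow> l"
      using bounded_imp_convergent_subsequence by blast
    then show "\<exists>r. strict_mono r \<and> P i (s \<circ> r)"
      unfolding P_def convergent_def o_def by auto
  qed
  have "P i (s \<circ> r)" if "strict_mono r" "P i s" for i and r s :: "nat \<Rightarrow> nat"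
    using convergent_subseq_convergent[OF that(2)[unfolded P_def] that(1)]
    by (simp add: P_def o_def)
  then have tail: "P i (diagseq \<circ> (+) (Suc i))" for i by (rule diagseq_holds)
  have P_diag: "P i diagseq" for i
    using tail[of i]
      convergent_ignore_initial_segment[of "\<lambda>k. inner (R (diagseq k) (fst (p i))) (snd (p i))" "Suc i"]
    by (simp add: P_def o_def add.commute)
  have convQ: "convergent (\<lambda>k. inner (R (diagseq k) f) g)" if "f \<in> Q" "g \<in> Q" for f g
  proof -
    have "(f, g) \<in> range p" using that p by simp
    then obtain i where i: "p i = (f, g)" by (metis rangeE)
    show ?thesis using P_diag[of i] unfolding P_def i by simp
  qed
  have convH: "convergent (\<lambda>k. inner (R (diagseq k) f) g)" if "g \<in> Q" for f g
  proof (rule convergent_on_dense_imp_convergent[OF Q(2) convQ[OF _ that]])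
    fix n f h
    show "\<bar>inner (R (diagseq n) f) g - inner (R (diagseq n) h) g\<bar> \<le> (K * norm g) * dist f h"
      using abs_le[of "diagseq n" "f - h" g]
      by (simp add: linear_diff[OF lin] inner_diff_left dist_norm mult_ac)
  qed
  have "\<exists>u. \<forall>g. (\<lambda>k. inner (R (diagseq k) f) g) \<longlonglongrightarrow> inner u g" for f
    using bounded_weakly_Cauchy_imp_weak_limit[OF Q(2) convH bound] by blast
  then obtain U where "\<And>f g. (\<lambda>k. inner (R (diagseq k) f) g) \<longlonglongrightarrow> inner (U f) g"
    by metis
  with subseq_diagseq show ?thesis by blast
qed

section \<open>Complex inner product spaces\<close>

lemma scaleC_minus_one: "(- 1) *\<^sub>C (x::'a::complex_inner) = - x"
  using scaleC_of_real[of "-1" x] by simp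

lemma cinner_minus_left: "cinner (- x) (y::'a::complex_inner) = - cinner x y"
  using cinner_scaleC_left[of "-1" x y] by (simp add: scaleC_minus_one)

lemma cinner_diff_left: "cinner (x - y) (z::'a::complex_inner) = cinner x z - cinner y z"
  using cinner_add_left[of x "- y" z] by (simp add: cinner_minus_left)

lemma cinner_add_right: "cinner x (y + z) = cinner x y + cinner x (z::'a::complex_inner)"
  by (metis cinner_commute cinner_add_left complex_cnj_add)

lemma cinner_zero_right [simp]: "cinner x (0::'a::complex_inner) = 0"
  using cinner_add_right[of x 0 0] by simp

lemma cinner_diff_right: "cinner x (y - z) = cinner x y - cinner x (z::'a::complex_inner)"
  by (metis cinner_commute cinner_diff_left complex_cnj_diff)

lemma cinner_minus_right: "cinner x (- y) = - cinner x (y::'a::complex_inner)"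
  using cinner_diff_right[of x 0 y] by simp

lemma cinner_scaleC_right: "cinner x (c *\<^sub>C y) = cnj c * cinner x (y::'a::complex_inner)"
  by (metis cinner_commute cinner_scaleC_left complex_cnj_mult)

text \<open>
  The complex product is determined by the real one. Hence weak convergence, adjoints and
  orthogonality are treated below with the real inner product and transferred to the
  complex one by testing with \<open>\<i> *\<^sub>C g\<close>.
\<close>

lemma cinner_eq_Complex: "cinner x y = Complex (inner x y) (inner x (\<i> *\<^sub>C y))"
  for x y :: "'a::complex_inner"
  by (rule complex_eqI) (simp_all add: Re_cinner[symmetric] cinner_scaleC_right)

lemma norm_scaleC: "norm (c *\<^sub>C x) = cmod c * norm (x::'a::complex_inner)"
proof -
  have "inner (c *\<^sub>C x) (c *\<^sub>C x) = Re (c * cnj c * cinner x x)"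
    by (simp only: Re_cinner[symmetric] cinner_scaleC_right cinner_scaleC_left mult_ac)
  also have "\<dots> = (cmod c)\<^sup>2 * inner x x"
    by (simp add: complex_norm_square[symmetric] Re_cinner)
  finally have "(norm (c *\<^sub>C x))\<^sup>2 = (cmod c * norm x)\<^sup>2"
    by (simp add: power2_norm_eq_inner power_mult_distrib)
  then show ?thesis by simp
qed

lemma bounded_linear_scaleC_right: "bounded_linear (\<lambda>x::'a::complex_inner. c *\<^sub>C x)"
proof
  show "c *\<^sub>C (r *\<^sub>R x) = r *\<^sub>R (c *\<^sub>C x)" for r and x :: 'a
    by (simp add: scaleC_of_real[symmetric] scaleC_scaleC mult.commute)
  show "\<exists>K. \<forall>x::'a. norm (c *\<^sub>C x) \<le> norm x * K"
    by (rule exI[of _ "cmod c"]) (simp add: norm_scaleC mult.commute)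
qed (rule scaleC_add_right)

lemmas tendsto_scaleC_right = bounded_linear.tendsto[OF bounded_linear_scaleC_right]
lemmas scaleC_diff_right = linear_diff[OF bounded_linear.linear[OF bounded_linear_scaleC_right]]

lemma tendsto_cinner:
  fixes f g :: "'b \<Rightarrow> 'a::complex_inner"
  assumes "(f \<longlongrightarrow> a) F" and "(g \<longlongrightarrow> b) F"
  shows "((\<lambda>x. cinner (f x) (g x)) \<longlongrightarrow> cinner a b) F"
  unfolding cinner_eq_Complex by (intro tendsto_intros tendsto_scaleC_right assms)

lemma weak_limit_inner_imp_cinner:
  fixes x :: "nat \<Rightarrow> 'a::complex_inner"
  assumes "\<And>g. (\<lambda>n. inner (x n) g) \<longlonglongrightarrow> inner u g"
  shows "(\<lambda>n. cinner (x n) g) \<longlonglongrightarrow> cinner u g"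
  unfolding cinner_eq_Complex by (intro tendsto_intros assms)

lemma cinner_eqI:
  fixes v w :: "'a::complex_inner"
  assumes "closure D = UNIV" and "\<And>x. x \<in> D \<Longrightarrow> cinner x v = cinner x w"
  shows "v = w"
proof -
  have "inner x (v - w) = 0" if "x \<in> D" for x
    using assms(2)[OF that] by (simp add: Re_cinner[symmetric] cinner_diff_right)
  then show ?thesis using inner_dense_eq_0[OF assms(1), of "v - w"] by simp
qed

lemma csubspace_imp_subspace: "csubspace S \<Longrightarrow> subspace S"
  by (auto simp: csubspace_def subspace_def scaleC_of_real[symmetric])

lemma csubspace_diff: "csubspace S \<Longrightarrow> x \<in> S \<Longrightarrow> y \<in> S \<Longrightarrow> x - y \<in> S"
  by (rule subspace_diff[OF csubspace_imp_subspace])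

lemma clinear_on_diff:
  assumes "csubspace S" "clinear_on S A" "x \<in> S" "y \<in> S"
  shows "A (x - y) = A x - A y"
proof -
  have "(- 1) *\<^sub>C y \<in> S" using assms by (simp add: csubspace_def)
  then have "A (x + (- 1) *\<^sub>C y) = A x + (- 1) *\<^sub>C A y"
    using assms unfolding clinear_on_def by metis
  then show ?thesis by (simp add: scaleC_minus_one)
qed

lemma csubspace_UNIV: "csubspace UNIV" by (simp add: csubspace_def)

lemma clinear_on_UNIV_linear: "clinear_on UNIV A \<Longrightarrow> linear A"
  by (rule linearI) (auto simp: clinear_on_def scaleC_of_real[symmetric])

lemma bounded_operators_bounded_linear: "A \<in> bounded_operators \<Longrightarrow> bounded_linear A"
  unfolding bounded_operators_def bounded_linear_def bounded_linear_axioms_def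
  using clinear_on_UNIV_linear by (auto simp: mult.commute)

section \<open>Extending a bounded operator from a dense domain\<close>

text \<open>
  This situation occurs twice: for \<open>L0 + L0t\<close> on the domain of \<open>L0\<close>, and for the limit
  coefficient, which is at first given only on the range of the limit solution operator.
\<close>

locale dense_bounded =
  fixes D :: "'a::complex_hilbert set" and A :: "'a \<Rightarrow> 'a" and K :: real
  assumes csub: "csubspace D" and dense: "closure D = UNIV" and lin: "clinear_on D A"
    and bound: "\<And>\<phi>. \<phi> \<in> D \<Longrightarrow> norm (A \<phi>) \<le> K * norm \<phi>"
begin

lemma graph_closure_sequence:
  assumes "(x, y) \<in> closure ((\<lambda>\<phi>. (\<phi>, A \<phi>)) ` D)"
  shows "\<exists>\<phi>. (\<forall>n. \<phi> n \<in> D) \<and> \<phi> \<longlonglongrightarrow> x \<and> (\<lambda>n. A (\<phi> n)) \<longlonglongrightarrow> y"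
proof -
  from assms obtain p where p: "\<And>n. p n \<in> (\<lambda>\<phi>. (\<phi>, A \<phi>)) ` D" "p \<longlonglongrightarrow> (x, y)"
    unfolding closure_sequential by blast
  have mem: "fst (p n) \<in> D" and eq: "A (fst (p n)) = snd (p n)" for n using p(1)[of n] by auto
  show ?thesis
    using tendsto_fst[OF p(2)] tendsto_snd[OF p(2)]
    by (intro exI[of _ "\<lambda>n. fst (p n)"]) (simp add: mem eq)
qed

lemma closure_op_in_graph: "(x, closure_op D A x) \<in> closure ((\<lambda>\<phi>. (\<phi>, A \<phi>)) ` D)"
  and closure_op_eqI:
    "(x, y) \<in> closure ((\<lambda>\<phi>. (\<phi>, A \<phi>)) ` D) \<Longrightarrow> closure_op D A x = y"
proof -
  let ?G = "closure ((\<lambda>\<phi>. (\<phi>, A \<phi>)) ` D)"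
  \<comment> \<open>A bounded operator maps the Cauchy sequence approximating \<open>x\<close> to a Cauchy sequence.\<close>
  have ex: "\<exists>y. (x, y) \<in> ?G" for x
  proof -
    have "x \<in> closure D" using dense by simp
    then obtain \<phi> where \<phi>: "\<And>n. \<phi> n \<in> D" "\<phi> \<longlonglongrightarrow> x"
      unfolding closure_sequential by blast
    have le: "dist (A (\<phi> m)) (A (\<phi> n)) \<le> (\<bar>K\<bar> + 1) * dist (\<phi> m) (\<phi> n)" for m n
    proof -
      have "norm (A (\<phi> m - \<phi> n)) \<le> K * norm (\<phi> m - \<phi> n)"
        by (intro bound csubspace_diff[OF csub] \<phi>(1))
      also have "\<dots> \<le> (\<bar>K\<bar> + 1) * norm (\<phi> m - \<phi> n)" by (intro mult_right_mono) auto
      finally show ?thesis by (simp add: dist_norm clinear_on_diff[OF csub lin \<phi>(1) \<phi>(1)])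
    qed
    have "Cauchy (\<lambda>n. A (\<phi> n))"
    proof (rule metric_CauchyI)
      fix e :: real assume "e > 0"
      then have "e / (\<bar>K\<bar> + 1) > 0" by simp
      then obtain N where "\<And>m n. m \<ge> N \<Longrightarrow> n \<ge> N \<Longrightarrow> dist (\<phi> m) (\<phi> n) < e / (\<bar>K\<bar> + 1)"
        using metric_CauchyD[OF LIMSEQ_imp_Cauchy[OF \<phi>(2)]] by blast
      then have "dist (A (\<phi> m)) (A (\<phi> n)) < e" if "m \<ge> N" "n \<ge> N" for m n
        using le[of m n] that by (smt (verit) pos_less_divide_eq mult.commute)
      then show "\<exists>N. \<forall>m\<ge>N. \<forall>n\<ge>N. dist (A (\<phi> m)) (A (\<phi> n)) < e" by blast
    qed
    then obtain y where "(\<lambda>n. A (\<phi> n)) \<longlonglongrightarrow> y" using Cauchy_convergent convergent_def by blast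
    then have "(\<lambda>n. (\<phi> n, A (\<phi> n))) \<longlonglongrightarrow> (x, y)" using \<phi>(2) by (intro tendsto_Pair)
    then show ?thesis
      unfolding closure_sequential using \<phi>(1)
      by (intro exI[of _ y] exI[of _ "\<lambda>n. (\<phi> n, A (\<phi> n))"]) auto
  qed
  have uniq: "y = y'" if y: "(x, y) \<in> ?G" and y': "(x, y') \<in> ?G" for x y y'
  proof -
    obtain \<phi> where \<phi>: "\<And>n. \<phi> n \<in> D" "\<phi> \<longlonglongrightarrow> x" "(\<lambda>n. A (\<phi> n)) \<longlonglongrightarrow> y"
      using graph_closure_sequence[OF y] by blast
    obtain \<psi> where \<psi>: "\<And>n. \<psi> n \<in> D" "\<psi> \<longlonglongrightarrow> x" "(\<lambda>n. A (\<psi> n)) \<longlonglongrightarrow> y'"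
      using graph_closure_sequence[OF y'] by blast
    have "norm (y - y') \<le> K * norm (x - x)"
    proof (rule LIMSEQ_le)
      show "(\<lambda>n. norm (A (\<phi> n) - A (\<psi> n))) \<longlonglongrightarrow> norm (y - y')"
        by (intro tendsto_intros \<phi> \<psi>)
      show "(\<lambda>n. K * norm (\<phi> n - \<psi> n)) \<longlonglongrightarrow> K * norm (x - x)"
        by (intro tendsto_intros \<phi> \<psi>)
      show "\<exists>N. \<forall>n\<ge>N. norm (A (\<phi> n) - A (\<psi> n)) \<le> K * norm (\<phi> n - \<psi> n)"
        using bound[OF csubspace_diff[OF csub \<phi>(1) \<psi>(1)]]
        by (simp add: clinear_on_diff[OF csub lin \<phi>(1) \<psi>(1)])
    qed
    then show ?thesis by simp
  qed
  show "(x, closure_op D A x) \<in> ?G"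
    unfolding closure_op_def by (rule theI'[of "\<lambda>y. (x, y) \<in> ?G"]) (metis ex uniq)
  then show "(x, y) \<in> ?G \<Longrightarrow> closure_op D A x = y" by (metis uniq)
qed

lemma closure_op_limit:
  "\<exists>\<phi>. (\<forall>n. \<phi> n \<in> D) \<and> \<phi> \<longlonglongrightarrow> x \<and> (\<lambda>n. A (\<phi> n)) \<longlonglongrightarrow> closure_op D A x"
  by (rule graph_closure_sequence[OF closure_op_in_graph])

lemma closure_op_extends: "\<phi> \<in> D \<Longrightarrow> closure_op D A \<phi> = A \<phi>"
  by (rule closure_op_eqI, rule subsetD[OF closure_subset], rule imageI)

lemma closure_op_sequenceI:
  assumes "\<And>n. \<phi> n \<in> D" and "\<phi> \<longlonglongrightarrow> x" and "(\<lambda>n. A (\<phi> n)) \<longlonglongrightarrow> y"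
  shows "closure_op D A x = y"
proof (rule closure_op_eqI)
  have "(\<lambda>n. (\<phi> n, A (\<phi> n))) \<longlonglongrightarrow> (x, y)" using assms by (intro tendsto_Pair)
  then show "(x, y) \<in> closure ((\<lambda>\<phi>. (\<phi>, A \<phi>)) ` D)"
    unfolding closure_sequential using assms(1)
    by (intro exI[of _ "\<lambda>n. (\<phi> n, A (\<phi> n))"]) auto
qed

lemma closure_op_bounded: "norm (closure_op D A x) \<le> K * norm x"
proof -
  obtain \<phi> where \<phi>: "\<And>n. \<phi> n \<in> D" "\<phi> \<longlonglongrightarrow> x" "(\<lambda>n. A (\<phi> n)) \<longlonglongrightarrow> closure_op D A x"
    using closure_op_limit[of x] by blast
  show ?thesis
    by (rule LIMSEQ_le[OF tendsto_norm[OF \<phi>(3)] tendsto_mult[OF tendsto_const tendsto_norm[OF \<phi>(2)]]])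
      (use bound \<phi>(1) in blast)
qed

lemma closure_op_bounded_operator: "closure_op D A \<in> bounded_operators"
proof -
  let ?S = "closure_op D A"
  have "?S (x + y) = ?S x + ?S y" for x y
  proof -
    obtain \<phi> where \<phi>: "\<And>n. \<phi> n \<in> D" "\<phi> \<longlonglongrightarrow> x" "(\<lambda>n. A (\<phi> n)) \<longlonglongrightarrow> ?S x"
      using closure_op_limit[of x] by blast
    obtain \<psi> where \<psi>: "\<And>n. \<psi> n \<in> D" "\<psi> \<longlonglongrightarrow> y" "(\<lambda>n. A (\<psi> n)) \<longlonglongrightarrow> ?S y"
      using closure_op_limit[of y] by blast
    show ?thesis
    proof (rule closure_op_sequenceI)
      show "\<phi> n + \<psi> n \<in> D" for n using csub \<phi>(1) \<psi>(1) by (simp add: csubspace_def)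
      show "(\<lambda>n. \<phi> n + \<psi> n) \<longlonglongrightarrow> x + y" by (intro tendsto_intros \<phi> \<psi>)
      have "A (\<phi> n + \<psi> n) = A (\<phi> n) + A (\<psi> n)" for n
        using lin \<phi>(1) \<psi>(1) by (simp add: clinear_on_def)
      then show "(\<lambda>n. A (\<phi> n + \<psi> n)) \<longlonglongrightarrow> ?S x + ?S y"
        by (simp add: tendsto_add \<phi> \<psi>)
    qed
  qed
  moreover have "?S (c *\<^sub>C x) = c *\<^sub>C ?S x" for c x
  proof -
    obtain \<phi> where \<phi>: "\<And>n. \<phi> n \<in> D" "\<phi> \<longlonglongrightarrow> x" "(\<lambda>n. A (\<phi> n)) \<longlonglongrightarrow> ?S x"
      using closure_op_limit[of x] by blast
    show ?thesis
    proof (rule closure_op_sequenceI)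
      show "c *\<^sub>C \<phi> n \<in> D" for n using csub \<phi>(1) by (simp add: csubspace_def)
      show "(\<lambda>n. c *\<^sub>C \<phi> n) \<longlonglongrightarrow> c *\<^sub>C x" by (intro tendsto_scaleC_right \<phi>)
      have "A (c *\<^sub>C \<phi> n) = c *\<^sub>C A (\<phi> n)" for n
        using lin \<phi>(1) by (simp add: clinear_on_def)
      then show "(\<lambda>n. A (c *\<^sub>C \<phi> n)) \<longlonglongrightarrow> c *\<^sub>C ?S x"
        by (simp add: tendsto_scaleC_right \<phi>)
    qed
  qed
  ultimately show ?thesis
    unfolding bounded_operators_def clinear_on_def using closure_op_bounded by blast
qed

end

section \<open>Adjoints\<close>

lemma adj_op_eqI:
  assumes "closure D = UNIV" and "\<And>\<phi>. \<phi> \<in> D \<Longrightarrow> cinner (A \<phi>) v = cinner \<phi> w"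
  shows "adj_op D A v = w"
  unfolding adj_op_def
proof (rule the_equality)
  fix w' assume "\<forall>\<phi>\<in>D. cinner (A \<phi>) v = cinner \<phi> w'"
  then show "w' = w" by (intro cinner_eqI[OF assms(1)]) (simp add: assms(2)[symmetric])
qed (use assms(2) in blast)

lemma cinner_adj_op:
  assumes "closure D = UNIV" and "v \<in> adj_dom D A" and "\<phi> \<in> D"
  shows "cinner (A \<phi>) v = cinner \<phi> (adj_op D A v)"
proof -
  obtain w where w: "\<And>\<phi>. \<phi> \<in> D \<Longrightarrow> cinner (A \<phi>) v = cinner \<phi> w"
    using assms(2) unfolding adj_dom_def by blast
  have "adj_op D A v = w" using adj_op_eqI[of D A v w] assms(1) w by blast
  then show ?thesis using w[OF assms(3)] by simp
qed

text \<open>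
  The Riesz theorem yields \<open>w\<close> for the real parts; the imaginary parts follow by replacing
  \<open>\<phi>\<close> with \<open>\<i> *\<^sub>C \<phi>\<close>, as \<open>C\<close> is complex linear.
\<close>

lemma bounded_operator_has_adjoint:
  fixes C :: "'a::complex_hilbert \<Rightarrow> 'a"
  assumes C: "C \<in> bounded_operators"
  shows "\<exists>w. \<forall>\<phi>. cinner (C \<phi>) f = cinner \<phi> w"
proof -
  have "bounded_linear (\<lambda>\<phi>. inner (C \<phi>) f)"
    by (rule bounded_linear_compose[OF bounded_linear_inner_left
          bounded_operators_bounded_linear[OF C]])
  then have "\<exists>w\<in>UNIV. \<forall>\<phi>\<in>UNIV. inner w \<phi> = inner (C \<phi>) f"
    by (rule riesz_on_closed_subspace[OF subspace_UNIV closed_UNIV])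
  then obtain w where w: "\<And>\<phi>. inner w \<phi> = inner (C \<phi>) f" by blast
  have "cinner (C \<phi>) f = cinner \<phi> w" for \<phi>
  proof (rule complex_eqI)
    show "Re (cinner (C \<phi>) f) = Re (cinner \<phi> w)"
      using w[of \<phi>] by (simp add: Re_cinner inner_commute)
    have "C (\<i> *\<^sub>C \<phi>) = \<i> *\<^sub>C C \<phi>"
      using C by (simp add: bounded_operators_def clinear_on_def)
    then have "Re (cinner (\<i> *\<^sub>C C \<phi>) f) = Re (cinner (\<i> *\<^sub>C \<phi>) w)"
      using w[of "\<i> *\<^sub>C \<phi>"] by (simp add: Re_cinner inner_commute)
    then show "Im (cinner (C \<phi>) f) = Im (cinner \<phi> w)"
      by (simp add: cinner_scaleC_left)
  qed
  then show ?thesis by blast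
qed

lemma csubspace_orthogonal:
  assumes M: "csubspace M" and orth: "\<And>x. x \<in> M \<Longrightarrow> inner x y = 0" and x: "x \<in> M"
  shows "cinner x y = 0"
proof (rule complex_eqI)
  show "Re (cinner x y) = Re 0" using orth[OF x] by (simp add: Re_cinner)
  have "\<i> *\<^sub>C x \<in> M" using M x by (simp add: csubspace_def)
  from orth[OF this] have "Re (cinner (\<i> *\<^sub>C x) y) = 0" by (simp only: Re_cinner)
  then show "Im (cinner x y) = Im 0" by (simp add: cinner_scaleC_left)
qed

lemma bounded_operators_diff_scaleC:
  assumes A: "A \<in> bounded_operators" and B: "B \<in> bounded_operators"
  shows "(\<lambda>x. A x - c *\<^sub>C B x) \<in> bounded_operators"
proof -
  obtain K L where K: "\<And>x. norm (A x) \<le> K * norm x" and L: "\<And>x. norm (B x) \<le> L * norm x"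
    using A B unfolding bounded_operators_def by blast
  have "norm (A x - c *\<^sub>C B x) \<le> (K + cmod c * L) * norm x" for x
  proof -
    have "norm (A x - c *\<^sub>C B x) \<le> norm (A x) + cmod c * norm (B x)"
      using norm_triangle_ineq4[of "A x" "c *\<^sub>C B x"] by (simp add: norm_scaleC)
    also have "\<dots> \<le> K * norm x + cmod c * (L * norm x)"
      by (intro add_mono mult_left_mono K L) simp
    finally show ?thesis by (simp add: algebra_simps)
  qed
  moreover have "clinear_on UNIV (\<lambda>x. A x - c *\<^sub>C B x)"
    using A B unfolding bounded_operators_def clinear_on_def
    by (auto simp: scaleC_add_right scaleC_diff_right scaleC_scaleC mult.commute)
  ultimately show ?thesis unfolding bounded_operators_def by blast
qed

section \<open>The graph space and its indefinite inner product\<close>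

locale friedrichs_pair =
  fixes D :: "'a::complex_hilbert set" and L0 L0t :: "'a \<Rightarrow> 'a"
  assumes L0: "linear_operator D L0" and L0t: "linear_operator D L0t"
    and T1: "cond_T1 D L0 L0t" and T2: "cond_T2 D L0 L0t"
begin

abbreviation "W \<equiv> graph_space D L0 L0t"
abbreviation "L1 \<equiv> op_L1 D L0 L0t"
abbreviation "L1t \<equiv> op_L1t D L0 L0t"
abbreviation "S \<equiv> closure_op D (\<lambda>\<phi>. L0 \<phi> + L0t \<phi>)"
abbreviation "form \<equiv> indef_inner D L0 L0t"
abbreviation "Fclass \<alpha> \<beta> \<equiv> coeff_class \<alpha> \<beta> D (\<lambda>\<phi>. L0 \<phi> + L0t \<phi>)"

lemma dense_D: "closure D = UNIV" and csubspace_D: "csubspace D"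
  using T1 L0 by (auto simp: cond_T1_def linear_operator_def)

lemma cinner_L0: "\<phi> \<in> D \<Longrightarrow> \<psi> \<in> D \<Longrightarrow> cinner (L0 \<phi>) \<psi> = cinner \<phi> (L0t \<psi>)"
  using T1 by (simp add: cond_T1_def)

lemma cinner_L0t: "\<phi> \<in> D \<Longrightarrow> \<psi> \<in> D \<Longrightarrow> cinner (L0t \<phi>) \<psi> = cinner \<phi> (L0 \<psi>)"
  by (metis cinner_L0 cinner_commute)

lemma dense_bounded_sum: "\<exists>K. dense_bounded D (\<lambda>\<phi>. L0 \<phi> + L0t \<phi>) K"
proof -
  obtain l where l: "\<And>\<phi>. \<phi> \<in> D \<Longrightarrow> norm (L0 \<phi> + L0t \<phi>) \<le> 2 * l * norm \<phi>"
    using T2 by (auto simp: cond_T2_def)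
  have "dense_bounded D (\<lambda>\<phi>. L0 \<phi> + L0t \<phi>) (2 * l)"
  proof
    show "clinear_on D (\<lambda>\<phi>. L0 \<phi> + L0t \<phi>)"
      using L0 L0t by (auto simp: linear_operator_def clinear_on_def scaleC_add_right)
  qed (use csubspace_D dense_D l in auto)
  then show ?thesis by blast
qed

lemma S_bounded_operator: "S \<in> bounded_operators"
  using dense_bounded_sum dense_bounded.closure_op_bounded_operator by blast

lemma S_extends: "\<phi> \<in> D \<Longrightarrow> S \<phi> = L0 \<phi> + L0t \<phi>"
  using dense_bounded_sum dense_bounded.closure_op_extends by metis

lemma S_selfadjoint: "cinner (S x) y = cinner x (S y)"
proof -
  obtain K where "dense_bounded D (\<lambda>\<phi>. L0 \<phi> + L0t \<phi>) K" using dense_bounded_sum by blast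
  note lim = dense_bounded.closure_op_limit[OF this]
  obtain \<phi> where \<phi>: "\<And>n. \<phi> n \<in> D" "\<phi> \<longlonglongrightarrow> x" "(\<lambda>n. L0 (\<phi> n) + L0t (\<phi> n)) \<longlonglongrightarrow> S x"
    using lim[of x] by blast
  obtain \<psi> where \<psi>: "\<And>n. \<psi> n \<in> D" "\<psi> \<longlonglongrightarrow> y" "(\<lambda>n. L0 (\<psi> n) + L0t (\<psi> n)) \<longlonglongrightarrow> S y"
    using lim[of y] by blast
  have "cinner (L0 (\<phi> n) + L0t (\<phi> n)) (\<psi> n) = cinner (\<phi> n) (L0 (\<psi> n) + L0t (\<psi> n))" for n
    by (simp add: cinner_add_left cinner_add_right cinner_L0 cinner_L0t \<phi>(1) \<psi>(1))
  then have "(\<lambda>n. cinner (L0 (\<phi> n) + L0t (\<phi> n)) (\<psi> n)) \<longlonglongrightarrow> cinner x (S y)"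
    using tendsto_cinner[OF \<phi>(2) \<psi>(3)] by simp
  with tendsto_cinner[OF \<phi>(3) \<psi>(2)] show ?thesis by (rule LIMSEQ_unique)
qed

lemma inner_S: "inner (S x) y = inner x (S y)"
  using S_selfadjoint[of x y] by (metis Re_cinner)

lemma bounded_linear_S: "bounded_linear S"
  by (rule bounded_operators_bounded_linear[OF S_bounded_operator])

lemma clinear_S: "clinear_on UNIV S"
  using S_bounded_operator by (simp add: bounded_operators_def)

lemma in_graph_spaceI:
  assumes "\<And>\<phi>. \<phi> \<in> D \<Longrightarrow> cinner (L0t \<phi>) u = cinner \<phi> w"
  shows "u \<in> W" and "L1 u = w"
  using adj_op_eqI[OF dense_D assms] assms
  unfolding graph_space_def op_L1_def adj_dom_def by blast+

lemma cinner_L1: "u \<in> W \<Longrightarrow> \<phi> \<in> D \<Longrightarrow> cinner (L0t \<phi>) u = cinner \<phi> (L1 u)"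
  unfolding graph_space_def op_L1_def by (rule cinner_adj_op[OF dense_D])

lemma D_in_graph_space:
  assumes "\<psi> \<in> D"
  shows "\<psi> \<in> W" and "L1 \<psi> = L0 \<psi>"
  using in_graph_spaceI[of \<psi> "L0 \<psi>"] cinner_L0t assms by blast+

lemma L0_on_D: "\<phi> \<in> D \<Longrightarrow> L0 \<phi> = S \<phi> - L0t \<phi>" "\<phi> \<in> D \<Longrightarrow> L0t \<phi> = S \<phi> - L0 \<phi>"
  by (simp_all add: S_extends)

text \<open>
  Taking adjoints in \<open>L0 = S - L0t\<close> on the dense domain. This identity turns the form into an
  expression in \<open>L1\<close> and \<open>S\<close> alone.
\<close>

lemma L1t_eq:
  assumes "u \<in> W"
  shows "L1t u = S u - L1 u"
  unfolding op_L1t_def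
proof (rule adj_op_eqI[OF dense_D])
  fix \<phi> assume "\<phi> \<in> D"
  then show "cinner (L0 \<phi>) u = cinner \<phi> (S u - L1 u)"
    unfolding L0_on_D(1)[OF \<open>\<phi> \<in> D\<close>]
    by (simp add: cinner_diff_left cinner_diff_right S_selfadjoint cinner_L1[OF assms])
qed

text \<open>
  The adjoints of \<open>L0\<close> and \<open>L0t\<close> have the same domain, since their sum \<open>S\<close> is bounded. This is
  the direction needed to place a vector orthogonal to the range of \<open>L1 + C\<close> in the graph space.
\<close>

lemma in_graph_space_adjoint_L0I:
  assumes "\<And>\<phi>. \<phi> \<in> D \<Longrightarrow> cinner (L0 \<phi>) u = cinner \<phi> w"
  shows "u \<in> W" and "L1 u = S u - w"
proof -
  have "cinner (L0t \<phi>) u = cinner \<phi> (S u - w)" if "\<phi> \<in> D" for \<phi>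
    unfolding L0_on_D(2)[OF that]
    by (simp add: cinner_diff_left cinner_diff_right S_selfadjoint assms[OF that])
  then show "u \<in> W" "L1 u = S u - w" using in_graph_spaceI by blast+
qed

lemma csubspace_W: "csubspace W" and clinear_L1: "clinear_on W L1"
proof -
  have zero: "0 \<in> W" by (rule in_graph_spaceI(1)[of _ 0]) simp
  have add: "u + v \<in> W" "L1 (u + v) = L1 u + L1 v" if "u \<in> W" "v \<in> W" for u v
    using in_graph_spaceI[of "u + v" "L1 u + L1 v"] that by (simp_all add: cinner_add_right cinner_L1)
  have scale: "c *\<^sub>C u \<in> W" "L1 (c *\<^sub>C u) = c *\<^sub>C L1 u" if "u \<in> W" for c u
    using in_graph_spaceI[of "c *\<^sub>C u" "c *\<^sub>C L1 u"] that
    by (simp_all add: cinner_scaleC_right cinner_L1)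
  show "csubspace W" "clinear_on W L1"
    unfolding csubspace_def clinear_on_def using zero add scale by auto
qed

text \<open>
  Membership in an adjoint's graph is tested by scalar products with fixed vectors, so it
  survives weak limits.
\<close>

lemma graph_weakly_closed:
  assumes u: "\<And>n. u n \<in> W"
    and lim: "\<And>g. (\<lambda>n. inner (u n) g) \<longlonglongrightarrow> inner u' g"
    and lim1: "\<And>g. (\<lambda>n. inner (L1 (u n)) g) \<longlonglongrightarrow> inner w g"
  shows "u' \<in> W" and "L1 u' = w"
proof -
  have "cinner (L0t \<phi>) u' = cinner \<phi> w" if "\<phi> \<in> D" for \<phi>
  proof -
    have "cinner (u n) (L0t \<phi>) = cinner (L1 (u n)) \<phi>" for n
      using cinner_L1[OF u that] by (metis cinner_commute)
    then have "(\<lambda>n. cinner (u n) (L0t \<phi>)) \<longlonglongrightarrow> cinner w \<phi>"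
      using weak_limit_inner_imp_cinner[of "\<lambda>n. L1 (u n)", OF lim1] by simp
    with weak_limit_inner_imp_cinner[of u, OF lim] have "cinner u' (L0t \<phi>) = cinner w \<phi>"
      by (rule LIMSEQ_unique)
    then show ?thesis by (metis cinner_commute)
  qed
  then show "u' \<in> W" "L1 u' = w" using in_graph_spaceI by blast+
qed

lemma form_eq:
  "v \<in> W \<Longrightarrow> form u v = cinner (L1 u) v + cinner u (L1 v) - cinner u (S v)"
  by (simp add: indef_inner_def L1t_eq cinner_diff_right)

lemma form_hermitian:
  assumes "u \<in> W" "v \<in> W"
  shows "form v u = cnj (form u v)"
  using cinner_commute[of "L1 u" v] cinner_commute[of u "L1 v"] cinner_commute[of u "S v"]
  by (simp add: form_eq assms S_selfadjoint)

lemma Re_form: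
  "v \<in> W \<Longrightarrow> Re (form u v) = inner (L1 u) v + inner u (L1 v) - inner (S u) v"
  by (simp add: form_eq Re_cinner inner_S)

text \<open>
  The form lives on the boundary: it vanishes as soon as one argument lies in the minimal domain.
\<close>

lemma form_D_eq_0:
  assumes "\<phi> \<in> D" "v \<in> W"
  shows "form \<phi> v = 0"
  unfolding form_eq[OF assms(2)] D_in_graph_space(2)[OF assms(1)] L0_on_D(1)[OF assms(1)]
  by (simp add: cinner_diff_left S_selfadjoint cinner_L1[OF assms(2,1)])

lemma half_S: "(1 / 2) *\<^sub>C S \<phi> = (1 / 2) *\<^sub>R S \<phi>"
  using scaleC_of_real[of "1/2" "S \<phi>"] by simp

lemma Fclass_iff:
  "C \<in> Fclass \<alpha> \<beta> \<longleftrightarrow> C \<in> bounded_operators \<and>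
     (\<forall>\<phi>. \<alpha> * (norm \<phi>)\<^sup>2 \<le> inner (C \<phi> + (1 / 2) *\<^sub>R S \<phi>) \<phi> \<and>
       1 / \<beta> * (norm (C \<phi> + (1 / 2) *\<^sub>R S \<phi>))\<^sup>2 \<le> inner (C \<phi> + (1 / 2) *\<^sub>R S \<phi>) \<phi>)"
  unfolding coeff_class_def Let_def half_S Re_cinner by auto

end

section \<open>Boundary conditions and the coercive isomorphisms\<close>

text \<open>
  The second inequality of the class bounds \<open>B\<close> by \<open>\<beta>\<close>: combine it with Cauchy-Schwarz and
  divide by \<open>\<parallel>w\<parallel>\<close>.
\<close>

lemma norm_le_of_inner_lower_bound:
  fixes w :: "'a::real_inner"
  assumes "0 < \<beta>" and "1 / \<beta> * (norm w)\<^sup>2 \<le> inner w u"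
  shows "norm w \<le> \<beta> * norm u"
proof (cases "w = 0")
  case False
  have "(norm w)\<^sup>2 \<le> \<beta> * inner w u" using assms by (simp add: field_simps)
  also have "\<dots> \<le> \<beta> * (norm w * norm u)"
    using assms(1) by (intro mult_left_mono norm_cauchy_schwarz) auto
  finally have "norm w * norm w \<le> norm w * (\<beta> * norm u)"
    by (simp add: power2_eq_square mult_ac)
  then show ?thesis using False by (simp add: mult_le_cancel_left)
qed (use assms(1) in simp)

locale friedrichs_bvp = friedrichs_pair +
  fixes V :: "'a set" and \<alpha> \<beta> :: real
  assumes csubspace_V: "csubspace V" and V_subset: "V \<subseteq> W"
    and V: "cond_V D L0 L0t V" and \<alpha>: "0 < \<alpha>" and \<alpha>\<beta>: "\<alpha> < \<beta>"
begin

lemma \<beta>: "0 < \<beta>" using \<alpha> \<alpha>\<beta> by simp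

lemma V_W: "u \<in> V \<Longrightarrow> u \<in> W" using V_subset by blast

lemma in_VI:
  assumes "u \<in> W" and "\<And>v. v \<in> indef_perp D L0 L0t V \<Longrightarrow> form u v = 0"
  shows "u \<in> V"
proof -
  have "u \<in> indef_perp D L0 L0t (indef_perp D L0 L0t V)"
    using assms by (simp add: indef_perp_def)
  then show ?thesis using V unfolding cond_V_def by blast
qed

lemma form_V_perp:
  assumes "u \<in> V" "v \<in> indef_perp D L0 L0t V"
  shows "form u v = 0"
  using assms V_W[OF assms(1)] form_hermitian[of v u] by (auto simp: indef_perp_def)

text \<open>
  As \<open>V\<close> is a companion with respect to the form, it contains everything the form annihilates.
\<close>

lemma D_subset_V: "\<phi> \<in> D \<Longrightarrow> \<phi> \<in> V"
  by (rule in_VI) (auto simp: D_in_graph_space form_D_eq_0 indef_perp_def)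

lemma form_V_nonneg: "u \<in> V \<Longrightarrow> 0 \<le> Re (form u u)"
  using V by (auto simp: cond_V_def complex_nonneg_Reals_iff)

lemma form_perp_nonpos:
  assumes "v \<in> W" and "\<And>u. u \<in> V \<Longrightarrow> form u v = 0"
  shows "Re (form v v) \<le> 0"
proof -
  have "v \<in> indef_perp D L0 L0t V"
    using assms form_hermitian[OF V_W assms(1)] by (simp add: indef_perp_def)
  then show ?thesis using V by (auto simp: cond_V_def complex_nonpos_Reals_iff)
qed

text \<open>
  \<open>V\<close> is cut out of the graph space by the conditions \<open>[u|v] = 0\<close>, each of which is weakly
  continuous in the pair \<open>(u, L1 u)\<close>.
\<close>

lemma V_weakly_closed:
  assumes u: "\<And>n. u n \<in> V"
    and lim: "\<And>g. (\<lambda>n. inner (u n) g) \<longlonglongrightarrow> inner u' g"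
    and lim1: "\<And>g. (\<lambda>n. inner (L1 (u n)) g) \<longlonglongrightarrow> inner w g"
  shows "u' \<in> V" and "L1 u' = w"
proof -
  note W = graph_weakly_closed[of u, OF V_W[OF u] lim lim1]
  show "L1 u' = w" by (rule W(2))
  show "u' \<in> V"
  proof (rule in_VI[OF W(1)])
    fix v assume v: "v \<in> indef_perp D L0 L0t V"
    have "(\<lambda>n. form (u n) v) \<longlonglongrightarrow> form u' v"
      unfolding indef_inner_def W(2)
      by (intro tendsto_intros weak_limit_inner_imp_cinner lim lim1)
    then have "(\<lambda>n. 0) \<longlonglongrightarrow> form u' v" by (simp add: form_V_perp[OF u v])
    then show "form u' v = 0" by (simp add: LIMSEQ_const_iff)
  qed
qed

lemma V_closed:
  assumes "\<And>n. u n \<in> V" and "u \<longlonglongrightarrow> u'" and "(\<lambda>n. L1 (u n)) \<longlonglongrightarrow> w"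
  shows "u' \<in> V" and "L1 u' = w"
proof -
  have "(\<lambda>n. inner (u n) g) \<longlonglongrightarrow> inner u' g" "(\<lambda>n. inner (L1 (u n)) g) \<longlonglongrightarrow> inner w g" for g
    by (intro tendsto_intros assms)+
  then show "u' \<in> V" "L1 u' = w" using V_weakly_closed[of u u' w, OF assms(1)] by blast+
qed

context
  fixes C :: "'a \<Rightarrow> 'a"
  assumes C: "C \<in> Fclass \<alpha> \<beta>"
begin

lemma C_bounded_operator: "C \<in> bounded_operators"
  using C by (simp add: Fclass_iff)

lemma clinear_C: "clinear_on UNIV C"
  using C_bounded_operator by (simp add: bounded_operators_def)

lemma B_coercive:
  "\<alpha> * (norm \<phi>)\<^sup>2 \<le> inner (C \<phi> + (1 / 2) *\<^sub>R S \<phi>) \<phi>"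
  "1 / \<beta> * (norm (C \<phi> + (1 / 2) *\<^sub>R S \<phi>))\<^sup>2 \<le> inner (C \<phi> + (1 / 2) *\<^sub>R S \<phi>) \<phi>"
  using C by (simp_all add: Fclass_iff)

lemma norm_B_le: "norm (C \<phi> + (1 / 2) *\<^sub>R S \<phi>) \<le> \<beta> * norm \<phi>"
  by (rule norm_le_of_inner_lower_bound[OF \<beta> B_coercive(2)])

lemma inner_T:
  assumes "u \<in> W"
  shows "inner (L1 u + C u) u = Re (form u u) / 2 + inner (C u + (1 / 2) *\<^sub>R S u) u"
  by (simp add: Re_form[OF assms] inner_add_left inner_commute[of u "L1 u"] field_simps)

text \<open>
  Pairing \<open>(L1 + C) u\<close> with \<open>u\<close> leaves a nonnegative boundary term and the coercive term of \<open>B\<close>.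
\<close>

lemma T_lower_bound:
  assumes "u \<in> V"
  shows "\<alpha> * norm u \<le> norm (L1 u + C u)"
proof (cases "u = 0")
  case False
  have "\<alpha> * (norm u)\<^sup>2 \<le> inner (L1 u + C u) u"
    using inner_T[OF V_W[OF assms]] form_V_nonneg[OF assms] B_coercive(1)[of u] by linarith
  also have "\<dots> \<le> norm (L1 u + C u) * norm u" by (rule norm_cauchy_schwarz)
  finally have "norm u * (\<alpha> * norm u) \<le> norm u * norm (L1 u + C u)"
    by (simp add: power2_eq_square mult_ac)
  then show ?thesis using False by (simp add: mult_le_cancel_left)
qed simp

lemma clinear_T: "clinear_on V (\<lambda>u. L1 u + C u)"
  using clinear_L1 clinear_C V_W unfolding clinear_on_def
  by (auto simp: scaleC_add_right)

lemma inj_T: "inj_on (\<lambda>u. L1 u + C u) V"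
proof (rule inj_onI)
  fix u v assume uv: "u \<in> V" "v \<in> V" "L1 u + C u = L1 v + C v"
  have "\<alpha> * norm (u - v) \<le> norm (L1 (u - v) + C (u - v))"
    by (rule T_lower_bound[OF csubspace_diff[OF csubspace_V uv(1,2)]])
  also have "L1 (u - v) + C (u - v) = 0"
    using clinear_on_diff[OF csubspace_V clinear_T uv(1,2)] uv(3) by simp
  finally show "u = v" using \<alpha> by (simp add: mult_le_0_iff)
qed

text \<open>
  If \<open>T (u n)\<close> converges, the lower bound makes \<open>u n\<close> converge, hence also \<open>C (u n)\<close> and
  \<open>L1 (u n)\<close>, and \<open>V\<close> is closed for the graph norm.
\<close>

lemma closed_range_T: "closed ((\<lambda>u. L1 u + C u) ` V)"
  unfolding closed_sequential_limits
proof (intro allI impI, elim conjE)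
  fix y l assume y: "\<forall>n. y n \<in> (\<lambda>u. L1 u + C u) ` V" "y \<longlonglongrightarrow> l"
  from y(1) have "\<forall>n. \<exists>u. u \<in> V \<and> y n = L1 u + C u" by blast
  then obtain u where u: "\<And>n. u n \<in> V" "\<And>n. y n = L1 (u n) + C (u n)"
    using choice by metis
  have le: "\<alpha> * dist (u m) (u n) \<le> dist (y m) (y n)" for m n
    using T_lower_bound[OF csubspace_diff[OF csubspace_V u(1)[of m] u(1)[of n]]]
    by (simp add: clinear_on_diff[OF csubspace_V clinear_T u(1) u(1)] dist_norm u(2))
  have "Cauchy u"
  proof (rule metric_CauchyI)
    fix e :: real assume "e > 0"
    then obtain N where N: "\<And>m n. m \<ge> N \<Longrightarrow> n \<ge> N \<Longrightarrow> dist (y m) (y n) < \<alpha> * e"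
      using metric_CauchyD[OF LIMSEQ_imp_Cauchy[OF y(2)], of "\<alpha> * e"] \<alpha> by auto
    have "dist (u m) (u n) < e" if "m \<ge> N" "n \<ge> N" for m n
      using le_less_trans[OF le N[OF that]] \<alpha> by simp
    then show "\<exists>N. \<forall>m\<ge>N. \<forall>n\<ge>N. dist (u m) (u n) < e" by blast
  qed
  then obtain u' where u': "u \<longlonglongrightarrow> u'" using Cauchy_convergent convergent_def by blast
  have Cu: "(\<lambda>n. C (u n)) \<longlonglongrightarrow> C u'"
    by (rule bounded_linear.tendsto[OF bounded_operators_bounded_linear[OF C_bounded_operator] u'])
  have "(\<lambda>n. y n - C (u n)) \<longlonglongrightarrow> l - C u'" by (intro tendsto_diff y(2) Cu)
  then have "(\<lambda>n. L1 (u n)) \<longlonglongrightarrow> l - C u'" by (simp add: u(2))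
  note V' = V_closed[OF u(1) u' this]
  show "l \<in> (\<lambda>u. L1 u + C u) ` V" using V' by (intro image_eqI[of _ _ u']) auto
qed

lemma csubspace_range_T: "csubspace ((\<lambda>u. L1 u + C u) ` V)"
proof -
  let ?T = "\<lambda>u. L1 u + C u"
  have "0 - 0 \<in> V" using csubspace_V by (simp add: csubspace_def)
  then have "0 \<in> ?T ` V"
    using clinear_on_diff[OF csubspace_V clinear_T, of 0 0] by (intro image_eqI[of _ _ 0]) auto
  moreover have "?T u + ?T v \<in> ?T ` V" if "u \<in> V" "v \<in> V" for u v
    using clinear_T csubspace_V that unfolding clinear_on_def csubspace_def
    by (intro image_eqI[of _ _ "u + v"]) auto
  moreover have "c *\<^sub>C ?T u \<in> ?T ` V" if "u \<in> V" for c u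
    using clinear_T csubspace_V that unfolding clinear_on_def csubspace_def
    by (intro image_eqI[of _ _ "c *\<^sub>C u"]) auto
  ultimately show ?thesis unfolding csubspace_def by blast
qed

text \<open>
  Testing against the minimal domain shows that \<open>f\<close> belongs to the graph space and solves the
  adjoint equation \<open>L1t f = - w\<close>, where \<open>w\<close> is the adjoint of \<open>C\<close> applied to \<open>f\<close>; testing
  against all of \<open>V\<close> then says \<open>[u|f] = 0\<close> on \<open>V\<close>. The sign of the form on such \<open>f\<close> is opposite to
  the one that the coercivity of \<open>B\<close> requires unless \<open>f = 0\<close>.
\<close>

lemma orthogonal_range_T:
  assumes "\<And>x. x \<in> (\<lambda>u. L1 u + C u) ` V \<Longrightarrow> inner x f = 0"
  shows "f = 0"
proof -
  have orth: "cinner (L1 u) f + cinner (C u) f = 0" if "u \<in> V" for u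
    using csubspace_orthogonal[OF csubspace_range_T assms, of "L1 u + C u"] that
    by (simp add: cinner_add_left)
  obtain w where w: "\<And>\<phi>. cinner (C \<phi>) f = cinner \<phi> w"
    using bounded_operator_has_adjoint[OF C_bounded_operator] by blast
  have "cinner (L0 \<phi>) f = cinner \<phi> (- w)" if "\<phi> \<in> D" for \<phi>
    using orth[OF D_subset_V[OF that]]
    by (simp add: D_in_graph_space[OF that] w cinner_minus_right add_eq_0_iff2)
  note f = in_graph_space_adjoint_L0I[OF this]
  have L1f: "L1 f = S f + w" using f(2) by simp
  have perp: "form u f = 0" if "u \<in> V" for u
    using orth[OF that] by (simp add: form_eq[OF f(1)] L1f cinner_add_right w)
  have "Re (form f f) \<le> 0" by (rule form_perp_nonpos[OF f(1) perp])
  moreover have "inner f w = inner (C f) f" using w[of f] by (metis Re_cinner)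
  then have "Re (form f f) = 2 * inner (C f + (1 / 2) *\<^sub>R S f) f"
    by (simp add: Re_form[OF f(1)] L1f inner_add_left inner_add_right inner_commute)
  ultimately have "\<alpha> * (norm f)\<^sup>2 \<le> 0" using B_coercive(1)[of f] by simp
  then show "f = 0" using \<alpha> by (simp add: mult_le_0_iff)
qed

lemma range_T: "(\<lambda>u. L1 u + C u) ` V = UNIV"
  using orthogonal_trivial_imp_dense[OF csubspace_imp_subspace[OF csubspace_range_T]
      orthogonal_range_T] closed_range_T
  by (simp add: closure_closed)

lemma C_bounded: "\<exists>K\<ge>0. \<forall>u. norm (C u) \<le> K * norm u"
proof -
  obtain K where K: "\<And>u. norm (C u) \<le> K * norm u"
    using C_bounded_operator by (auto simp: bounded_operators_def)
  have "norm (C u) \<le> \<bar>K\<bar> * norm u" for u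
    by (rule order_trans[OF K]) (intro mult_right_mono, auto)
  then show ?thesis by (intro exI[of _ "\<bar>K\<bar>"]) auto
qed

lemma graph_isomorphism_T: "graph_isomorphism V L1 (\<lambda>u. L1 u + C u)"
proof -
  let ?T = "\<lambda>u. L1 u + C u"
  obtain K where K: "K \<ge> 0" "\<And>u. norm (C u) \<le> K * norm u" using C_bounded by blast
  have "norm (?T u) \<le> (1 + K) * graph_norm L1 u" for u
  proof -
    have "norm (?T u) \<le> norm (L1 u) + K * norm u"
      using norm_triangle_ineq[of "L1 u" "C u"] K(2)[of u] by linarith
    also have "\<dots> \<le> (1 + K) * graph_norm L1 u"
      using K(1) by (simp add: graph_norm_def algebra_simps)
    finally show ?thesis .
  qed
  moreover have "graph_norm L1 u \<le> (1 + (1 + K) / \<alpha>) * norm (?T u)" if "u \<in> V" for u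
  proof -
    have "norm (L1 u) \<le> norm (?T u) + norm (C u)"
      using norm_triangle_ineq4[of "?T u" "C u"] by simp
    then have "graph_norm L1 u \<le> norm (?T u) + (1 + K) * norm u"
      using K(2)[of u] by (simp add: graph_norm_def algebra_simps)
    also have "norm u \<le> norm (?T u) / \<alpha>"
      using T_lower_bound[OF that] \<alpha> by (simp add: field_simps)
    then have "(1 + K) * norm u \<le> (1 + K) * (norm (?T u) / \<alpha>)"
      using K(1) by (intro mult_left_mono) auto
    finally show ?thesis by (simp add: algebra_simps)
  qed
  ultimately show ?thesis
    unfolding graph_isomorphism_def bij_betw_def using clinear_T inj_T range_T by blast
qed

end

end

section \<open>Compactness with respect to G-convergence\<close>

lemma weak_limit_unique:
  fixes u v :: "'a::real_inner"
  assumes "\<And>g. (\<lambda>n. inner (x n) g) \<longlonglongrightarrow> inner u g" and "\<And>g. (\<lambda>n. inner (x n) g) \<longlonglongrightarrow> inner v g"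
  shows "u = v"
proof -
  have "inner g (u - v) = 0" for g
    using LIMSEQ_unique[OF assms(1)[of g] assms(2)[of g]]
    by (simp add: inner_diff_right inner_commute)
  then have "inner (u - v) (u - v) = 0" by blast
  then show ?thesis by simp
qed

text \<open>
  Weak lower semicontinuity of the squared norm, in the shape in which an inequality
  \<open>c \<parallel>y n\<parallel>\<^sup>2 \<le> a n\<close> passes to the limit. The sequence \<open>a\<close> need not converge: in the application
  it contains a quadratic term, and only the upper bound \<open>b\<close> has a limit.
\<close>

lemma norm_sq_weakly_lsc_bound:
  fixes y :: "nat \<Rightarrow> 'a::real_inner"
  assumes weak: "\<And>g. (\<lambda>n. inner (y n) g) \<longlonglongrightarrow> inner y' g"
    and "0 \<le> c" and le: "\<And>n. c * (norm (y n))\<^sup>2 \<le> a n" and upper: "\<And>n. a n \<le> b n"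
    and b: "b \<longlonglongrightarrow> l"
  shows "c * (norm y')\<^sup>2 \<le> l"
proof -
  \<comment> \<open>The square is bounded below by its tangent at the limit, which is weakly continuous.\<close>
  have "(\<lambda>n. c * (2 * inner (y n) y' - (norm y')\<^sup>2)) \<longlonglongrightarrow> c * (2 * inner y' y' - (norm y')\<^sup>2)"
    by (intro tendsto_intros weak)
  moreover have "c * (2 * inner (y n) y' - (norm y')\<^sup>2) \<le> b n" for n
  proof -
    have "0 \<le> (norm (y n - y'))\<^sup>2" by simp
    then have "2 * inner (y n) y' - (norm y')\<^sup>2 \<le> (norm (y n))\<^sup>2"
      unfolding power2_norm_eq_inner
      by (simp add: inner_diff_left inner_diff_right inner_commute)
    from mult_left_mono[OF this \<open>0 \<le> c\<close>] le[of n] upper[of n] show ?thesis by linarith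
  qed
  ultimately have "c * (2 * inner y' y' - (norm y')\<^sup>2) \<le> l"
    using b by (intro LIMSEQ_le) auto
  then show ?thesis by (simp add: power2_norm_eq_inner)
qed

context friedrichs_bvp
begin

text \<open>
  Here \<open>w\<close> is the weak limit of \<open>B n = f - L1 (u n) + S (u n)/2\<close>. The products
  \<open>\<langle>B n | u n\<rangle>\<close> pair two weakly convergent sequences, so they need not converge to \<open>\<langle>w|u'\<rangle>\<close>.
  But the equation gives \<open>Re \<langle>B n | u n\<rangle> = Re \<langle>f|u n\<rangle> - Re [u n|u n]/2\<close>, and the form is
  nonnegative on \<open>V\<close>, so its values can only drop in the limit. The limit superior of the
  products is therefore at most \<open>Re \<langle>w|u'\<rangle>\<close>, the direction that the two lower bounds require.
\<close>

lemma weak_limit_coercive: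
  assumes C: "\<And>n. C n \<in> Fclass \<alpha> \<beta>" and u: "\<And>n. u n \<in> V"
    and eq: "\<And>n. L1 (u n) + C n (u n) = f"
    and lim: "\<And>g. (\<lambda>n. inner (u n) g) \<longlonglongrightarrow> inner u' g"
    and lim1: "\<And>g. (\<lambda>n. inner (L1 (u n)) g) \<longlonglongrightarrow> inner (L1 u') g"
    and u': "u' \<in> V"
  defines "w \<equiv> f - L1 u' + (1 / 2) *\<^sub>R S u'"
  shows "\<alpha> * (norm u')\<^sup>2 \<le> inner w u'" and "1 / \<beta> * (norm w)\<^sup>2 \<le> inner w u'"
proof -
  define B where "B n = C n (u n) + (1 / 2) *\<^sub>R S (u n)" for n
  have B: "B n = f - L1 (u n) + (1 / 2) *\<^sub>R S (u n)" for n
    using eq[of n] by (simp add: B_def algebra_simps)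
  have limS: "(\<lambda>n. inner (S (u n)) g) \<longlonglongrightarrow> inner (S u') g" for g
    unfolding inner_S by (rule lim)
  have limB: "(\<lambda>n. inner (B n) g) \<longlonglongrightarrow> inner w g" for g
    unfolding B w_def inner_add_left inner_diff_left inner_scaleR_left
    by (intro tendsto_intros lim1 limS)
  define a where "a n = inner (B n) (u n)" for n
  \<comment> \<open>Replacing \<open>[u n|u n]\<close> in \<open>a n\<close> by its tangent at \<open>u'\<close> gives a bound that is affine in \<open>u n\<close>.\<close>
  define b where "b n = inner f (u n) - Re (form (u n) u') + Re (form u' u') / 2" for n
  have "a n \<le> b n" for n
  proof -
    have W: "u n \<in> W" "u' \<in> W" using V_W u u' by auto
    have d: "u n - u' \<in> V" by (rule csubspace_diff[OF csubspace_V u u'])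
    have "0 \<le> Re (form (u n - u') (u n - u'))" by (rule form_V_nonneg[OF d])
    also have "\<dots> = Re (form (u n) (u n)) - 2 * Re (form (u n) u') + Re (form u' u')"
      unfolding Re_form[OF V_W[OF d]] Re_form[OF W(1)] Re_form[OF W(2)]
        clinear_on_diff[OF csubspace_W clinear_L1 W] linear_diff[OF bounded_linear.linear[OF bounded_linear_S]]
      using inner_S[of "u n" u']
      by (simp add: inner_diff_left inner_diff_right inner_commute)
    finally have "0 \<le> Re (form (u n) (u n)) - 2 * Re (form (u n) u') + Re (form u' u')" .
    moreover have "a n = inner f (u n) - Re (form (u n) (u n)) / 2"
      using inner_T[OF C[of n] W(1)] by (simp add: a_def B_def eq)
    ultimately show ?thesis by (simp add: b_def)
  qed
  note ab = this
  have "b \<longlonglongrightarrow> inner f u' - Re (form u' u') + Re (form u' u') / 2"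
    unfolding b_def Re_form[OF V_W[OF u']] inner_commute[of f]
    by (intro tendsto_intros lim lim1 limS)
  moreover have "inner f u' - Re (form u' u') + Re (form u' u') / 2 = inner w u'"
    by (simp add: Re_form[OF V_W[OF u']] w_def inner_add_left inner_diff_left
        inner_commute[of u' "L1 u'"] field_simps)
  ultimately have b: "b \<longlonglongrightarrow> inner w u'" by simp
  show "\<alpha> * (norm u')\<^sup>2 \<le> inner w u'"
    by (rule norm_sq_weakly_lsc_bound[OF lim _ _ ab b])
      (use \<alpha> B_coercive(1)[OF C] in \<open>auto simp: a_def B_def\<close>)
  show "1 / \<beta> * (norm w)\<^sup>2 \<le> inner w u'"
    by (rule norm_sq_weakly_lsc_bound[OF limB _ _ ab b])
      (use \<beta> B_coercive(2)[OF C] in \<open>auto simp: a_def B_def\<close>)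
qed

lemma solution_operator:
  assumes C: "C \<in> Fclass \<alpha> \<beta>"
  defines "R \<equiv> inv_into V (\<lambda>u. L1 u + C u)"
  shows "R f \<in> V" and "L1 (R f) + C (R f) = f" and "\<alpha> * norm (R f) \<le> norm f"
    and "clinear_on UNIV R"
proof -
  let ?T = "\<lambda>u. L1 u + C u"
  have R: "R f \<in> V" "?T (R f) = f" for f
    unfolding R_def using range_T[OF C] inv_into_into[of f ?T V] f_inv_into_f[of f ?T V] by auto
  show "R f \<in> V" "?T (R f) = f" by (rule R)+
  show "\<alpha> * norm (R f) \<le> norm f" using T_lower_bound[OF C R(1)[of f]] by (simp only: R(2))
  have R_T: "R (?T u) = u" if "u \<in> V" for u
    unfolding R_def by (rule inv_into_f_f[OF inj_T[OF C] that])
  have "R (f + g) = R f + R g" for f g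
  proof -
    have "R f + R g \<in> V" using csubspace_V R(1) by (simp add: csubspace_def)
    moreover have "?T (R f + R g) = f + g"
      using clinear_T[OF C] R by (simp add: clinear_on_def)
    ultimately show ?thesis using R_T by metis
  qed
  moreover have "R (c *\<^sub>C f) = c *\<^sub>C R f" for c f
  proof -
    have "c *\<^sub>C R f \<in> V" using csubspace_V R(1) by (simp add: csubspace_def)
    moreover have "?T (c *\<^sub>C R f) = c *\<^sub>C f"
      using clinear_T[OF C] R by (simp add: clinear_on_def)
    ultimately show ?thesis using R_T by metis
  qed
  ultimately show "clinear_on UNIV R" by (simp add: clinear_on_def)
qed

text \<open>
  The solutions are bounded by \<open>\<parallel>f\<parallel>/\<alpha>\<close>, which yields the weak limit \<open>U\<close>. Their images under
  \<open>L1\<close> are bounded as well, by the equation and the uniform bounds on \<open>B n\<close> and \<open>S\<close>; against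
  the dense minimal domain they converge because \<open>L1\<close> is the adjoint of \<open>L0t\<close>. So no further
  subsequence is needed, and the graph identifies the limit as \<open>L1 (U f)\<close>.
\<close>

lemma solutions_weakly_compact:
  fixes C :: "nat \<Rightarrow> 'a \<Rightarrow> 'a"
  assumes separable: "countable Q" "closure Q = (UNIV :: 'a set)"
    and C: "\<And>n. C n \<in> Fclass \<alpha> \<beta>"
  defines "R \<equiv> \<lambda>n. inv_into V (\<lambda>u. L1 u + C n u)"
  shows "\<exists>r U. strict_mono r \<and> clinear_on UNIV U \<and> (\<forall>f. U f \<in> V) \<and>
    (\<forall>f g. (\<lambda>k. inner (R (r k) f) g) \<longlonglongrightarrow> inner (U f) g) \<and>
    (\<forall>f g. (\<lambda>k. inner (L1 (R (r k) f)) g) \<longlonglongrightarrow> inner (L1 (U f)) g)"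
proof -
  have R: "R n f \<in> V" "L1 (R n f) + C n (R n f) = f" "\<alpha> * norm (R n f) \<le> norm f"
    "clinear_on UNIV (R n)" for n f
    unfolding R_def using solution_operator[OF C] by auto
  have R_bound: "norm (R n f) \<le> 1 / \<alpha> * norm f" for n f
    using R(3)[of n f] \<alpha> by (simp add: field_simps)
  have "\<exists>r U. strict_mono r \<and> (\<forall>f g. (\<lambda>k. inner (R (r k) f) g) \<longlonglongrightarrow> inner (U f) g)"
    by (rule bounded_operators_weak_limit[where R = R, OF separable clinear_on_UNIV_linear[OF R(4)] R_bound])
  then obtain r U where r: "strict_mono r"
    and U: "\<And>f g. (\<lambda>k. inner (R (r k) f) g) \<longlonglongrightarrow> inner (U f) g"
    by blast
  have add: "U (f + g) = U f + U g" for f g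
  proof (rule weak_limit_unique[OF U])
    fix h
    have "(\<lambda>k. inner (R (r k) f) h + inner (R (r k) g) h) \<longlonglongrightarrow> inner (U f) h + inner (U g) h"
      by (intro tendsto_intros U)
    then show "(\<lambda>k. inner (R (r k) (f + g)) h) \<longlonglongrightarrow> inner (U f + U g) h"
      using R(4) by (simp add: clinear_on_def inner_add_left)
  qed
  have scale: "U (c *\<^sub>C f) = c *\<^sub>C U f" for c f
  proof (rule weak_limit_unique[OF U])
    fix h
    have "(\<lambda>k. Re (c * cinner (R (r k) f) h)) \<longlonglongrightarrow> Re (c * cinner (U f) h)"
      by (intro tendsto_intros weak_limit_inner_imp_cinner U)
    then show "(\<lambda>k. inner (R (r k) (c *\<^sub>C f)) h) \<longlonglongrightarrow> inner (c *\<^sub>C U f) h"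
      using R(4) by (simp add: clinear_on_def cinner_scaleC_left[symmetric] Re_cinner)
  qed
  have lim1: "U f \<in> V \<and> (\<forall>g. (\<lambda>k. inner (L1 (R (r k) f)) g) \<longlonglongrightarrow> inner (L1 (U f)) g)" for f
  proof -
    obtain K where K: "\<And>u. norm (S u) \<le> K * norm u"
      using S_bounded_operator unfolding bounded_operators_def by blast
    have "norm (L1 (R n f)) \<le> norm f + (\<beta> + \<bar>K\<bar> / 2) * (1 / \<alpha> * norm f)" for n
    proof -
      let ?u = "R n f" and ?B = "C n (R n f) + (1 / 2) *\<^sub>R S (R n f)"
      have "L1 ?u = f - C n ?u" using R(2)[of n f] by (simp only: eq_diff_eq)
      then have "L1 ?u = f - ?B + (1 / 2) *\<^sub>R S ?u" by (simp add: algebra_simps)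
      then have "norm (L1 ?u) \<le> norm f + norm ?B + norm (S ?u) / 2"
        using norm_triangle_ineq[of "f - ?B" "(1 / 2) *\<^sub>R S ?u"] norm_triangle_ineq4[of f ?B]
        by simp
      also have "\<dots> \<le> norm f + \<beta> * norm ?u + \<bar>K\<bar> * norm ?u / 2"
        using norm_B_le[OF C, of n ?u] K[of ?u] mult_right_mono[OF abs_ge_self[of K] norm_ge_zero[of ?u]]
        by linarith
      also have "\<dots> = norm f + (\<beta> + \<bar>K\<bar> / 2) * norm ?u" by (simp add: algebra_simps)
      also have "\<dots> \<le> norm f + (\<beta> + \<bar>K\<bar> / 2) * (1 / \<alpha> * norm f)"
        using \<beta> by (intro add_left_mono mult_left_mono R_bound) auto
      finally show ?thesis .
    qed
    note L1_bound = this
    have "convergent (\<lambda>k. inner (L1 (R (r k) f)) \<phi>)" if "\<phi> \<in> D" for \<phi>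
    proof -
      have "inner (L1 (R n f)) \<phi> = inner (R n f) (L0t \<phi>)" for n
        using cinner_L1[OF V_W[OF R(1)] that, of n f] by (metis Re_cinner inner_commute)
      then show ?thesis using U[of f "L0t \<phi>"] by (auto simp: convergent_def)
    qed
    from bounded_weakly_Cauchy_imp_weak_limit[OF dense_D this L1_bound]
    obtain w where w: "\<And>g. (\<lambda>k. inner (L1 (R (r k) f)) g) \<longlonglongrightarrow> inner w g" by blast
    show ?thesis
      using V_weakly_closed[of "\<lambda>k. R (r k) f" "U f" w, OF R(1) U w] w by simp
  qed
  have "clinear_on UNIV U" using add scale by (simp add: clinear_on_def)
  with r U lim1 show ?thesis by blast
qed

text \<open>
  The limit coefficient is constructed on the range of \<open>U\<close>. Both inequalities for \<open>w\<close> are used: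
  the second makes \<open>U\<close> injective and \<open>u \<mapsto> w\<close> bounded, the first makes the range dense.
\<close>

lemma coefficients_G_compact:
  fixes C :: "nat \<Rightarrow> 'a \<Rightarrow> 'a"
  assumes separable: "countable Q" "closure Q = (UNIV :: 'a set)"
    and C: "\<And>n. C n \<in> Fclass \<alpha> \<beta>"
  shows "\<exists>r C'. strict_mono r \<and> C' \<in> Fclass \<alpha> \<beta> \<and>
    G_converges W L1 V (\<lambda>k u. L1 u + C (r k) u) (\<lambda>u. L1 u + C' u)"
proof -
  define R where "R n = inv_into V (\<lambda>u. L1 u + C n u)" for n
  obtain r U where r: "strict_mono r" and U: "clinear_on UNIV U" and UV: "\<And>f. U f \<in> V"
    and lim: "\<And>f g. (\<lambda>k. inner (R (r k) f) g) \<longlonglongrightarrow> inner (U f) g"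
    and lim1: "\<And>f g. (\<lambda>k. inner (L1 (R (r k) f)) g) \<longlonglongrightarrow> inner (L1 (U f)) g"
    using solutions_weakly_compact[where C = C, OF separable C] unfolding R_def by blast
  have R: "R n f \<in> V" "L1 (R n f) + C n (R n f) = f" for n f
    unfolding R_def using solution_operator[OF C] by auto
  define w where "w f = f - L1 (U f) + (1 / 2) *\<^sub>R S (U f)" for f
  have w_lower: "\<alpha> * (norm (U f))\<^sup>2 \<le> inner (w f) (U f)"
    "1 / \<beta> * (norm (w f))\<^sup>2 \<le> inner (w f) (U f)" for f
    unfolding w_def
    using weak_limit_coercive[where C = "\<lambda>k. C (r k)" and u = "\<lambda>k. R (r k) f" and u' = "U f",
        OF C R lim lim1 UV] by auto
  have w_le: "norm (w f) \<le> \<beta> * norm (U f)" for f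
    by (rule norm_le_of_inner_lower_bound[OF \<beta> w_lower(2)])
  have U_diff: "U (f - g) = U f - U g" for f g
    by (rule clinear_on_diff[OF csubspace_UNIV U]) auto
  have zeros: "L1 0 = 0" "S 0 = 0"
    using clinear_on_diff[OF csubspace_W clinear_L1, of 0 0] csubspace_W
      clinear_on_diff[OF csubspace_UNIV clinear_S, of 0 0] by (auto simp: csubspace_def)
  have U_inj: "inj U"
  proof (rule injI)
    fix f g assume "U f = U g"
    then have "U (f - g) = 0" by (simp add: U_diff)
    then have "w (f - g) = f - g" "norm (w (f - g)) \<le> 0"
      using w_le[of "f - g"] by (simp_all add: w_def zeros)
    then show "f = g" by simp
  qed
  have w_add: "w (f + g) = w f + w g" for f g
  proof -
    have "U (f + g) = U f + U g" using U by (simp add: clinear_on_def)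
    moreover have "L1 (U f + U g) = L1 (U f) + L1 (U g)" "S (U f + U g) = S (U f) + S (U g)"
      using clinear_L1 clinear_S V_W[OF UV] by (auto simp: clinear_on_def)
    ultimately show ?thesis by (simp add: w_def algebra_simps)
  qed
  have w_scale: "w (c *\<^sub>C f) = c *\<^sub>C w f" for c f
  proof -
    have "U (c *\<^sub>C f) = c *\<^sub>C U f" using U by (simp add: clinear_on_def)
    moreover have "L1 (c *\<^sub>C U f) = c *\<^sub>C L1 (U f)" "S (c *\<^sub>C U f) = c *\<^sub>C S (U f)"
      using clinear_L1 clinear_S V_W[OF UV] by (auto simp: clinear_on_def)
    ultimately show ?thesis
      by (simp add: w_def half_S[symmetric] scaleC_add_right scaleC_diff_right scaleC_scaleC
          scaleC_of_real[symmetric] mult.commute)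
  qed
  have U_add: "U f + U g = U (f + g)" and U_scale: "c *\<^sub>C U f = U (c *\<^sub>C f)" for f g c
    using U by (simp_all add: clinear_on_def)
  have csub: "csubspace (range U)"
    unfolding csubspace_def
  proof (intro conjI ballI allI)
    show "0 \<in> range U" using U_diff[of 0 0] by (metis diff_self rangeI)
  qed (auto simp: U_add U_scale)
  have dense: "closure (range U) = UNIV"
  proof (rule orthogonal_trivial_imp_dense[OF csubspace_imp_subspace[OF csub]])
    fix y assume "\<And>x. x \<in> range U \<Longrightarrow> inner x y = 0"
    then have "inner (U y) y = 0" by blast
    \<comment> \<open>The vector \<open>y\<close> orthogonal to the range is tested against its own image \<open>U y\<close>.\<close>
    moreover have "inner (w y) (U y) = inner (U y) y - Re (form (U y) (U y)) / 2"
      by (simp add: w_def Re_form[OF V_W[OF UV]] inner_add_left inner_diff_left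
          inner_commute[of y] inner_commute[of "U y" "L1 (U y)"] field_simps)
    ultimately have "\<alpha> * (norm (U y))\<^sup>2 \<le> 0"
      using w_lower(1)[of y] form_V_nonneg[OF UV[of y]] by linarith
    then have "U y = U 0" using \<alpha> U_diff[of 0 0] by (simp add: mult_le_0_iff)
    then show "y = 0" by (rule injD[OF U_inj])
  qed
  define B0 where "B0 u = w (inv U u)" for u
  have B0: "B0 (U f) = w f" for f by (simp add: B0_def inv_f_f[OF U_inj])
  interpret B: dense_bounded "range U" B0 \<beta>
  proof
    show "clinear_on (range U) B0"
      unfolding clinear_on_def by (auto simp: U_add U_scale B0 w_add w_scale)
  qed (use csub dense w_le B0 in auto)
  define B where "B = closure_op (range U) B0"
  have B_U: "B (U f) = w f" for f unfolding B_def using B.closure_op_extends B0 by auto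
  have B_lower: "\<alpha> * (norm x)\<^sup>2 \<le> inner (B x) x" "1 / \<beta> * (norm (B x))\<^sup>2 \<le> inner (B x) x" for x
  proof -
    obtain \<phi> where \<phi>: "\<And>n. \<phi> n \<in> range U" "\<phi> \<longlonglongrightarrow> x" "(\<lambda>n. B0 (\<phi> n)) \<longlonglongrightarrow> B x"
      using B.closure_op_limit[of x] unfolding B_def by blast
    have le: "\<alpha> * (norm (\<phi> n))\<^sup>2 \<le> inner (B0 (\<phi> n)) (\<phi> n)"
      "1 / \<beta> * (norm (B0 (\<phi> n)))\<^sup>2 \<le> inner (B0 (\<phi> n)) (\<phi> n)" for n
      using \<phi>(1)[of n] w_lower B0 by auto
    have inner: "(\<lambda>n. inner (B0 (\<phi> n)) (\<phi> n)) \<longlonglongrightarrow> inner (B x) x"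
      by (intro tendsto_intros \<phi>)
    have "(\<lambda>n. \<alpha> * (norm (\<phi> n))\<^sup>2) \<longlonglongrightarrow> \<alpha> * (norm x)\<^sup>2"
      by (intro tendsto_intros \<phi>)
    then show "\<alpha> * (norm x)\<^sup>2 \<le> inner (B x) x"
      by (rule LIMSEQ_le[OF _ inner]) (use le(1) in auto)
    have "(\<lambda>n. 1 / \<beta> * (norm (B0 (\<phi> n)))\<^sup>2) \<longlonglongrightarrow> 1 / \<beta> * (norm (B x))\<^sup>2"
      by (intro tendsto_mult tendsto_power tendsto_norm tendsto_const \<phi>)
    then show "1 / \<beta> * (norm (B x))\<^sup>2 \<le> inner (B x) x"
      by (rule LIMSEQ_le[OF _ inner]) (use le(2) in auto)
  qed
  define C' where "C' x = B x - (1 / 2) *\<^sub>C S x" for x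
  have "C' \<in> bounded_operators"
    unfolding C'_def B_def
    by (rule bounded_operators_diff_scaleC[OF B.closure_op_bounded_operator S_bounded_operator])
  moreover have "C' x + (1 / 2) *\<^sub>R S x = B x" for x by (simp add: C'_def half_S)
  ultimately have C': "C' \<in> Fclass \<alpha> \<beta>" by (simp add: Fclass_iff B_lower[simplified])
  have inv: "inv_into V (\<lambda>u. L1 u + C' u) f = U f" for f
  proof (rule inv_into_f_eq[OF inj_T[OF C'] UV])
    show "L1 (U f) + C' (U f) = f" by (simp add: C'_def half_S B_U w_def)
  qed
  have "weakly_converges W L1 (\<lambda>k. R (r k) f) (U f)" for f
    unfolding weakly_converges_def graph_cinner_def
    by (intro conjI allI ballI V_W R UV tendsto_add weak_limit_inner_imp_cinner lim lim1)
  then have "G_converges W L1 V (\<lambda>k u. L1 u + C (r k) u) (\<lambda>u. L1 u + C' u)"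
    unfolding G_converges_def inv using graph_isomorphism_T C C' by (auto simp: R_def)
  with r C' show ?thesis by blast
qed

end

theorem theorem2p10:
  fixes D V :: "'a::complex_hilbert set"
    and L0 L0t :: "'a \<Rightarrow> 'a"
    and \<alpha> \<beta> :: real
    and C :: "nat \<Rightarrow> 'a \<Rightarrow> 'a"
  assumes separable: "\<exists>Q :: 'a set. countable Q \<and> closure Q = UNIV"
    and "linear_operator D L0" and "linear_operator D L0t"
    and "cond_T1 D L0 L0t" and "cond_T2 D L0 L0t"
    and "csubspace V" and "V \<subseteq> graph_space D L0 L0t" and "cond_V D L0 L0t V"
    and "0 < \<alpha>" and "\<alpha> < \<beta>"
    and "\<And>n. C n \<in> coeff_class \<alpha> \<beta> D (\<lambda>\<phi>. L0 \<phi> + L0t \<phi>)"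
  shows "\<exists>(r :: nat \<Rightarrow> nat) C'.
    strict_mono r \<and>
    C' \<in> coeff_class \<alpha> \<beta> D (\<lambda>\<phi>. L0 \<phi> + L0t \<phi>) \<and>
    G_converges (graph_space D L0 L0t) (op_L1 D L0 L0t) V
      (\<lambda>k u. op_L1 D L0 L0t u + C (r k) u)
      (\<lambda>u. op_L1 D L0 L0t u + C' u)"
proof -
  interpret friedrichs_bvp D L0 L0t V \<alpha> \<beta>
    using assms(2-10) by unfold_locales auto
  obtain Q :: "'a set" where Q: "countable Q" "closure Q = UNIV" using separable by blast
  show ?thesis by (rule coefficients_G_compact[where C = C, OF Q assms(11)])
qed

end
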